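(* Let $K$ be a convex body in $\mathbb{R}^n$. Then for every $\varepsilon>0$ there is a convex body $W\subset K$ such that $\partial W$ is of class $C^{1,1}$ and $$\mathcal{H}^{n-1}(\partial K\,\triangle\,\partial W)<\varepsilon.$$ In fact, for every $\varepsilon>0$ there is $\delta_o>0$ such that for every $\delta\in(0,\delta_o)$ the set $W$ defined as the union of all closed balls of radius $\delta$ that are contained in $K$ is a convex body contained in $K$ with $\partial W$ of class $C^{1,1}$ and $\mathcal{H}^{n-1}(\partial K\,\triangle\,\partial W)<\varepsilon$.
   Context: A convex body is a compact convex set in $\mathbb{R}^n$ with nonempty interior. $A\triangle B=(A\setminus B)\cup(B\setminus A)$ is the symmetric difference, and $\mathcal{H}^{s}$ is the $s$-dimensional Hausdorff measure. A real function on an open set $U$ is of class $C^{1,1}(U)$ if it is $C^1$ on $U$ and its derivative is Lipschitz continuous on $U$. The boundary $\partial W$ is of class $C^{1,1}$ if it is locally (in suitable Euclidean coordinates) the graph of a $C^{1,1}$ function. *)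

theory Defs
  imports "HOL-Analysis.Analysis"
begin

definition convex_body :: "'a::euclidean_space set \<Rightarrow> bool" where
  "convex_body K \<longleftrightarrow> compact K \<and> convex K \<and> interior K \<noteq> {}"

text \<open>
  Hausdorff measure with the normalisation that makes \<open>\<H>\<^sup>n\<close> agree with Lebesgue measure
  on n-dimensional Euclidean space. The case split implements the convention
  that a nonempty set has \<open>diam\<^sup>0 = 1\<close>, because \<open>0 powr 0 = 0\<close> in Isabelle. Covering sets are
  explicitly bounded, because \<open>diameter\<close> is an unspecified real number on unbounded sets.
\<close>

definition hausdorff_gauge :: "real \<Rightarrow> 'a::metric_space set \<Rightarrow> real" where
  "hausdorff_gauge s E =
     (if E = {} then 0
      else if s = 0 then 1
      else unit_ball_vol s * (diameter E / 2) powr s)"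

definition hausdorff_premeasure :: "real \<Rightarrow> real \<Rightarrow> 'a::metric_space set \<Rightarrow> ennreal" where
  "hausdorff_premeasure s d A =
     (INF E \<in> {E :: nat \<Rightarrow> 'a set. A \<subseteq> (\<Union>i. E i) \<and> (\<forall>i. bounded (E i) \<and> diameter (E i) \<le> d)}.
        \<Sum>i. ennreal (hausdorff_gauge s (E i)))"

definition hausdorff_measure :: "real \<Rightarrow> 'a::metric_space set \<Rightarrow> ennreal" where
  "hausdorff_measure s A = (SUP d \<in> {0<..}. hausdorff_premeasure s d A)"

text \<open>
  Euclidean (n-1)-space is realised as a hyperplane \<open>H\<close> through the origin of the ambient space,
  i.e. as a linear subspace. For a relatively open \<open>U\<close> in \<open>H\<close> the derivative of \<open>f\<close> is represented
  by its gradient \<open>g x \<in> H\<close>, which is uniquely determined because \<open>f\<close> is differentiated along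
  \<open>H\<close> only; passing from the derivative to the gradient is an isometry. The values of
  \<open>f\<close> outside \<open>U\<close> are irrelevant.
\<close>

definition C11_on :: "'a::euclidean_space set \<Rightarrow> 'a set \<Rightarrow> ('a \<Rightarrow> real) \<Rightarrow> bool" where
  "C11_on H U f \<longleftrightarrow>
     (\<exists>g. (\<forall>x\<in>U. g x \<in> H \<and> (f has_derivative (\<lambda>h. g x \<bullet> h)) (at x within U)) \<and>
          continuous_on U g \<and> (\<exists>L. L-lipschitz_on U g))"

text \<open>
  Choosing Euclidean coordinates amounts to choosing the unit vector \<open>u\<close> of the last
  coordinate axis: translations and rotations inside the hyperplane orthogonal to \<open>u\<close> do not affect
  whether a set is the graph of a \<open>C\<^sup>1\<^sup>,\<^sup>1\<close> function.
\<close>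

definition C11_boundary :: "'a::euclidean_space set \<Rightarrow> bool" where
  "C11_boundary W \<longleftrightarrow>
     (\<forall>p \<in> frontier W. \<exists>u N V f. norm u = 1 \<and> open N \<and> p \<in> N \<and>
        openin (top_of_set {x. u \<bullet> x = 0}) V \<and> C11_on {x. u \<bullet> x = 0} V f \<and>
        frontier W \<inter> N = (\<lambda>x. x + f x *\<^sub>R u) ` V)"

definition union_of_inner_balls :: "real \<Rightarrow> 'a::euclidean_space set \<Rightarrow> 'a set" where
  "union_of_inner_balls \<delta> K = \<Union>{cball x \<delta> | x. cball x \<delta> \<subseteq> K}"

end

theory Submission
  imports Defs
begin

text \<open>
  Let \<open>A = {x. cball x \<delta> \<subseteq> K}\<close> be the inner parallel body and \<open>W\<close> the union of the inner balls,
  i.e. the outer \<open>\<delta>\<close>-parallel body of \<open>A\<close>. The normals of \<open>W\<close> are \<open>(y - p y) / \<delta>\<close> with \<open>p\<close> the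
  nearest point map of \<open>A\<close>, hence Lipschitz, and the inner balls of radius \<open>\<delta>\<close> make the local graphs
  differentiable with a quadratic error.

  For the measure estimate put \<open>s = n - 1\<close>. Nearest point maps onto convex sets are 1-Lipschitz. The map \<open>p\<close>
  sends \<open>\<partial>K \<inter> W\<close> onto \<open>\<partial>A\<close>, and if \<open>K\<close> contains a ball of radius \<open>r\<close>, then \<open>A\<close> contains a
  translate of \<open>(1 - \<delta>/r) K\<close>. Therefore \<open>\<H>\<^sup>s(\<partial>K \<inter> W) \<ge> \<H>\<^sup>s(\<partial>A) \<ge> (1 - \<delta>/r)\<^sup>s \<H>\<^sup>s(\<partial>K)\<close>, so that the
  measure of \<open>\<partial>K - W\<close> tends to 0. Finally \<open>\<partial>W - \<partial>K\<close> lies in the nearest point projection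
  of \<open>\<partial>K - W\<close> to \<open>W\<close>.
\<close>

section \<open>Hausdorff measure as a metric outer measure\<close>

lemma hausdorff_gauge_empty [simp]: "hausdorff_gauge s {} = 0"
  by (simp add: hausdorff_gauge_def)

text \<open>The exponent 0, which occurs in dimension one, is why \<open>r\<close> is positive: then
  \<open>r powr 0 = 1\<close> matches the gauge of a nonempty set.\<close>

lemma hausdorff_gauge_le:
  assumes "0 \<le> s" "0 < r" "bounded E" "diameter E \<le> 2 * r"
  shows "hausdorff_gauge s E \<le> unit_ball_vol s * r powr s"
proof (cases "E = {} \<or> s = 0")
  case True
  then show ?thesis using assms by (auto simp: hausdorff_gauge_def)
next
  case False
  have "(diameter E / 2) powr s \<le> r powr s"
    using assms diameter_ge_0[OF assms(3)] by (intro powr_mono2) auto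
  then show ?thesis
    using False assms(1) by (simp add: hausdorff_gauge_def mult_left_mono)
qed

lemma hausdorff_gauge_lipschitz_image:
  assumes "0 \<le> s" "0 < L" "bounded E" and f: "L-lipschitz_on E f"
  shows "hausdorff_gauge s (f ` E) \<le> L powr s * hausdorff_gauge s E"
    and "bounded (f ` E)" and "diameter (f ` E) \<le> L * diameter E"
proof -
  have dist: "dist (f x) (f y) \<le> L * diameter E" if "x \<in> E" "y \<in> E" for x y
  proof -
    have "dist (f x) (f y) \<le> L * dist x y"
      using f that by (rule lipschitz_onD)
    also have "\<dots> \<le> L * diameter E"
      using assms that by (simp add: diameter_bounded_bound)
    finally show ?thesis .
  qed
  then show "bounded (f ` E)"
    by (auto simp: bounded_two_points)
  show diam: "diameter (f ` E) \<le> L * diameter E"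
  proof (cases "E = {}")
    case False
    then show ?thesis
      using dist by (auto simp: diameter_def intro!: cSUP_least)
  qed simp
  show "hausdorff_gauge s (f ` E) \<le> L powr s * hausdorff_gauge s E"
  proof (cases "E = {} \<or> s = 0")
    case True
    then show ?thesis using \<open>0 < L\<close> by (auto simp: hausdorff_gauge_def)
  next
    case False
    have "(diameter (f ` E) / 2) powr s \<le> (L * (diameter E / 2)) powr s"
      using diam diameter_ge_0[OF \<open>bounded (f ` E)\<close>] \<open>0 \<le> s\<close> by (intro powr_mono2) auto
    also have "\<dots> = L powr s * (diameter E / 2) powr s"
      by (rule powr_mult)
    finally have "unit_ball_vol s * (diameter (f ` E) / 2) powr s
        \<le> unit_ball_vol s * (L powr s * (diameter E / 2) powr s)"
      using \<open>0 \<le> s\<close> by (intro mult_left_mono) auto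
    then show ?thesis
      using False by (simp add: hausdorff_gauge_def mult_ac)
  qed
qed

section \<open>Covers, premeasures and countable subadditivity\<close>

lemma hausdorff_premeasure_le:
  assumes "A \<subseteq> (\<Union>i. E i)" "\<And>i. bounded (E i)" "\<And>i. diameter (E i) \<le> d"
  shows "hausdorff_premeasure s d A \<le> (\<Sum>i. ennreal (hausdorff_gauge s (E i)))"
  unfolding hausdorff_premeasure_def using assms by (intro INF_lower) auto

lemma hausdorff_premeasure_greatest:
  assumes "\<And>E. A \<subseteq> (\<Union>i. E i) \<Longrightarrow> (\<And>i. bounded (E i)) \<Longrightarrow> (\<And>i. diameter (E i) \<le> d) \<Longrightarrow>
    c \<le> (\<Sum>i. ennreal (hausdorff_gauge s (E i)))"
  shows "c \<le> hausdorff_premeasure s d A"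
  unfolding hausdorff_premeasure_def using assms by (intro INF_greatest) auto

lemma hausdorff_premeasure_antimono:
  "d \<le> d' \<Longrightarrow> hausdorff_premeasure s d' A \<le> hausdorff_premeasure s d A"
  by (intro hausdorff_premeasure_greatest hausdorff_premeasure_le) (auto intro: order_trans)

lemma hausdorff_premeasure_le_measure:
  "0 < d \<Longrightarrow> hausdorff_premeasure s d A \<le> hausdorff_measure s A"
  unfolding hausdorff_measure_def by (intro SUP_upper) auto

lemma hausdorff_measure_least:
  assumes "\<And>d. 0 < d \<Longrightarrow> hausdorff_premeasure s d A \<le> c"
  shows "hausdorff_measure s A \<le> c"
  unfolding hausdorff_measure_def using assms by (intro SUP_least) auto

lemma hausdorff_premeasure_single:
  assumes "bounded E" "diameter E \<le> d" "0 \<le> d"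
  shows "hausdorff_premeasure s d E \<le> ennreal (hausdorff_gauge s E)"
proof -
  \<comment> \<open>Covers are sequences, so \<open>E\<close> is padded with empty sets, which have
    gauge 0 and diameter 0.\<close>
  have "hausdorff_premeasure s d E
      \<le> (\<Sum>i. ennreal (hausdorff_gauge s (if i = (0::nat) then E else {})))"
    using assms by (intro hausdorff_premeasure_le) auto
  also have "\<dots> = (\<Sum>i\<in>{0}. ennreal (hausdorff_gauge s (if i = (0::nat) then E else {})))"
    by (intro suminf_finite) auto
  finally show ?thesis by simp
qed

text \<open>Each \<open>B i\<close> gets a cover that is optimal up to \<open>e / 2^(i+1)\<close>.
  These errors add up to \<open>e\<close>, and a pairing of indices turns the double sequence of
  covering sets into a single one.\<close>

lemma hausdorff_premeasure_subadditive:
  assumes "A \<subseteq> (\<Union>i::nat. B i)"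
  shows "hausdorff_premeasure s d A \<le> (\<Sum>i. hausdorff_premeasure s d (B i))"
proof (rule ennreal_le_epsilon)
  fix e :: real
  assume e: "0 < e" and fin: "(\<Sum>i. hausdorff_premeasure s d (B i)) < top"
  have "\<exists>E. B i \<subseteq> (\<Union>j. E j) \<and> (\<forall>j. bounded (E j) \<and> diameter (E j) \<le> d) \<and>
      (\<Sum>j. ennreal (hausdorff_gauge s (E j)))
        \<le> hausdorff_premeasure s d (B i) + ennreal (e * (1/2)^Suc i)" for i :: nat
  proof -
    have "hausdorff_premeasure s d (B i) \<noteq> \<infinity>"
      using fin by (auto simp add: less_top dest!: ennreal_suminf_lessD)
    then obtain E where
      "E \<in> {E. B i \<subseteq> (\<Union>i. E i) \<and> (\<forall>i. bounded (E i) \<and> diameter (E i) \<le> d)}"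
      "(\<Sum>j. ennreal (hausdorff_gauge s (E j)))
        < hausdorff_premeasure s d (B i) + ennreal (e * (1/2)^Suc i)"
      using INF_approx_ennreal[OF _ hausdorff_premeasure_def, of "e * (1/2)^Suc i" s d "B i"] e
      by auto
    then show ?thesis by (intro exI[of _ E]) (auto intro: less_imp_le)
  qed
  then obtain E where cov: "\<And>i. B i \<subseteq> (\<Union>j::nat. E i j)"
    and E: "\<And>i j. bounded (E i j)" "\<And>i j. diameter (E i j) \<le> d"
    and le: "\<And>i::nat. (\<Sum>j. ennreal (hausdorff_gauge s (E i j)))
        \<le> hausdorff_premeasure s d (B i) + ennreal (e * (1/2)^Suc i)"
    by metis
  let ?F = "\<lambda>k. E (fst (prod_decode k)) (snd (prod_decode k))"
  have "A \<subseteq> (\<Union>k. ?F k)"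
  proof
    fix x assume "x \<in> A"
    then obtain i j where "x \<in> E i j" using assms cov by blast
    then have "x \<in> ?F (prod_encode (i, j))" by simp
    then show "x \<in> (\<Union>k. ?F k)" by blast
  qed
  then have "hausdorff_premeasure s d A \<le> (\<Sum>k. ennreal (hausdorff_gauge s (?F k)))"
    by (rule hausdorff_premeasure_le) (rule E)+
  also have "\<dots> = (\<Sum>i. \<Sum>j. ennreal (hausdorff_gauge s (E i j)))"
    using suminf_ennreal_2dimen[of "\<lambda>i. \<Sum>j. ennreal (hausdorff_gauge s (E i j))"
        "\<lambda>(i, j). ennreal (hausdorff_gauge s (E i j))"] by (simp add: split_def)
  also have "\<dots> \<le> (\<Sum>i. hausdorff_premeasure s d (B i) + ennreal (e * (1/2)^Suc i))"
    by (intro suminf_le le) auto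
  also have "\<dots> = (\<Sum>i. hausdorff_premeasure s d (B i)) + (\<Sum>i. ennreal e * ennreal ((1/2)^Suc i))"
    using e by (subst suminf_add[symmetric])
      (auto simp del: ennreal_suminf_cmult simp add: ennreal_mult[symmetric])
  also have "\<dots> = (\<Sum>i. hausdorff_premeasure s d (B i)) + e"
    unfolding ennreal_suminf_cmult
    by (subst suminf_ennreal_eq[OF zero_le_power power_half_series]) auto
  finally show "hausdorff_premeasure s d A \<le> (\<Sum>i. hausdorff_premeasure s d (B i)) + e" .
qed

lemma hausdorff_measure_subadditive:
  assumes "A \<subseteq> (\<Union>i::nat. B i)"
  shows "hausdorff_measure s A \<le> (\<Sum>i. hausdorff_measure s (B i))"
proof (rule hausdorff_measure_least)
  fix d :: real assume "0 < d"
  have "hausdorff_premeasure s d A \<le> (\<Sum>i. hausdorff_premeasure s d (B i))"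
    by (rule hausdorff_premeasure_subadditive[OF assms])
  also have "\<dots> \<le> (\<Sum>i. hausdorff_measure s (B i))"
    using \<open>0 < d\<close> by (intro suminf_le hausdorff_premeasure_le_measure) auto
  finally show "hausdorff_premeasure s d A \<le> (\<Sum>i. hausdorff_measure s (B i))" .
qed

lemma hausdorff_premeasure_mono:
  "A \<subseteq> B \<Longrightarrow> hausdorff_premeasure s d A \<le> hausdorff_premeasure s d B"
  by (intro hausdorff_premeasure_greatest hausdorff_premeasure_le) auto

lemma hausdorff_measure_mono:
  "A \<subseteq> B \<Longrightarrow> hausdorff_measure s A \<le> hausdorff_measure s B"
  unfolding hausdorff_measure_def by (intro SUP_mono) (auto intro: hausdorff_premeasure_mono)

lemma hausdorff_premeasure_empty [simp]:
  assumes "0 \<le> d" shows "hausdorff_premeasure s d {} = 0"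
  using hausdorff_premeasure_single[of "{}" d s] assms by simp

lemma hausdorff_measure_empty [simp]: "hausdorff_measure s {} = 0"
  using hausdorff_measure_least[of s "{}" 0] by simp

lemma hausdorff_premeasure_Un:
  assumes "0 \<le> d"
  shows "hausdorff_premeasure s d (A \<union> B) \<le> hausdorff_premeasure s d A + hausdorff_premeasure s d B"
proof -
  let ?C = "\<lambda>i::nat. if i = 0 then A else if i = 1 then B else {}"
  have "A \<union> B \<subseteq> (\<Union>i. ?C i)"
    by (auto split: if_splits)
  then have "hausdorff_premeasure s d (A \<union> B) \<le> (\<Sum>i. hausdorff_premeasure s d (?C i))"
    by (rule hausdorff_premeasure_subadditive)
  also have "\<dots> = (\<Sum>i\<in>{0,1}. hausdorff_premeasure s d (?C i))"
    using assms by (intro suminf_finite) auto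
  finally show ?thesis by simp
qed

lemma hausdorff_measure_Un:
  "hausdorff_measure s (A \<union> B) \<le> hausdorff_measure s A + hausdorff_measure s B"
proof (rule hausdorff_measure_least)
  fix d :: real assume "0 < d"
  then have "hausdorff_premeasure s d (A \<union> B)
      \<le> hausdorff_premeasure s d A + hausdorff_premeasure s d B"
    by (intro hausdorff_premeasure_Un) simp
  also have "\<dots> \<le> hausdorff_measure s A + hausdorff_measure s B"
    using \<open>0 < d\<close> by (intro add_mono hausdorff_premeasure_le_measure)
  finally show "hausdorff_premeasure s d (A \<union> B) \<le> hausdorff_measure s A + hausdorff_measure s B" .
qed

lemma hausdorff_premeasure_finite_Union:
  assumes "finite I" "0 \<le> d"
  shows "hausdorff_premeasure s d (\<Union>i\<in>I. E i) \<le> (\<Sum>i\<in>I. hausdorff_premeasure s d (E i))"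
  using assms(1)
proof induction
  case empty
  then show ?case using \<open>0 \<le> d\<close> by simp
next
  case (insert i I)
  have "hausdorff_premeasure s d (\<Union>j\<in>insert i I. E j)
      \<le> hausdorff_premeasure s d (E i) + hausdorff_premeasure s d (\<Union>j\<in>I. E j)"
    using hausdorff_premeasure_Un[OF \<open>0 \<le> d\<close>, of s "E i"] by simp
  also have "\<dots> \<le> hausdorff_premeasure s d (E i) + (\<Sum>j\<in>I. hausdorff_premeasure s d (E j))"
    using insert.IH by (intro add_left_mono)
  finally show ?case using insert by simp
qed

text \<open>A cover of \<open>A\<close> at scale \<open>d / L\<close> is mapped to a cover of the
  image at scale \<open>d\<close>. The covering sets are first cut with \<open>A\<close> because
  \<open>f\<close> is Lipschitz only there.\<close>

lemma hausdorff_measure_lipschitz_image: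
  assumes "0 \<le> s" "0 < L" and f: "L-lipschitz_on A f"
  shows "hausdorff_measure s (f ` A) \<le> ennreal (L powr s) * hausdorff_measure s A"
proof (rule hausdorff_measure_least)
  fix d :: real assume "0 < d"
  define c where "c = L powr s"
  have "0 < c" using \<open>0 < L\<close> by (simp add: c_def)
  have cancel: "ennreal c * (ennreal (inverse c) * x) = x" "ennreal (inverse c) * (ennreal c * x) = x" for x
    using \<open>0 < c\<close> by (simp_all add: mult.assoc[symmetric] ennreal_mult'[symmetric])
  \<comment> \<open>With the factor on the left, the right side is a bare infimum over covers, so
    the inequality can be checked cover by cover.\<close>
  have "ennreal (inverse c) * hausdorff_premeasure s d (f ` A) \<le> hausdorff_premeasure s (d / L) A"
  proof (rule hausdorff_premeasure_greatest)
    fix E :: "nat \<Rightarrow> 'a set"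
    assume cov: "A \<subseteq> (\<Union>i. E i)" and bE: "\<And>i. bounded (E i)" and dE: "\<And>i. diameter (E i) \<le> d / L"
    have bEA: "bounded (E i \<inter> A)" for i using bE bounded_subset by blast
    have lip: "L-lipschitz_on (E i \<inter> A) f" for i
      using f by (rule lipschitz_on_subset) auto
    note im = hausdorff_gauge_lipschitz_image[OF \<open>0 \<le> s\<close> \<open>0 < L\<close> bEA lip]
    have diam: "diameter (f ` (E i \<inter> A)) \<le> d" for i
    proof -
      have "diameter (E i \<inter> A) \<le> d / L"
        using diameter_subset[OF Int_lower1 bE, of i A] dE[of i] by linarith
      then have "L * diameter (E i \<inter> A) \<le> d"
        using \<open>0 < L\<close> by (simp add: field_simps)
      then show ?thesis using im(3)[of i] by linarith
    qed
    have mono: "hausdorff_gauge s (E i \<inter> A) \<le> hausdorff_gauge s (E i)" for i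
    proof -
      have "(diameter (E i \<inter> A) / 2) powr s \<le> (diameter (E i) / 2) powr s"
        using diameter_subset[OF Int_lower1 bE, of i A] diameter_ge_0[OF bEA[of i]] \<open>0 \<le> s\<close>
        by (intro powr_mono2) auto
      then show ?thesis
        using \<open>0 \<le> s\<close> by (auto simp: hausdorff_gauge_def intro!: mult_left_mono)
    qed
    have "hausdorff_premeasure s d (f ` A) \<le> (\<Sum>i. ennreal (hausdorff_gauge s (f ` (E i \<inter> A))))"
    proof (rule hausdorff_premeasure_le)
      show "f ` A \<subseteq> (\<Union>i. f ` (E i \<inter> A))" using cov by blast
    qed (rule im(2) diam)+
    also have "\<dots> \<le> (\<Sum>i. ennreal c * ennreal (hausdorff_gauge s (E i)))"
    proof (intro suminf_le)
      fix i
      have "hausdorff_gauge s (f ` (E i \<inter> A)) \<le> c * hausdorff_gauge s (E i)"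
        using im(1)[of i] mult_left_mono[OF mono[of i], of c] \<open>0 < c\<close>
        unfolding c_def by linarith
      then show "ennreal (hausdorff_gauge s (f ` (E i \<inter> A)))
          \<le> ennreal c * ennreal (hausdorff_gauge s (E i))"
        using \<open>0 < c\<close> by (simp add: ennreal_mult'[symmetric] ennreal_leI)
    qed auto
    finally have "ennreal (inverse c) * hausdorff_premeasure s d (f ` A)
        \<le> ennreal (inverse c) * (ennreal c * (\<Sum>i. ennreal (hausdorff_gauge s (E i))))"
      by (simp add: mult_left_mono)
    then show "ennreal (inverse c) * hausdorff_premeasure s d (f ` A)
        \<le> (\<Sum>i. ennreal (hausdorff_gauge s (E i)))"
      by (simp only: cancel)
  qed
  also have "\<dots> \<le> hausdorff_measure s A"
    using \<open>0 < d\<close> \<open>0 < L\<close> by (intro hausdorff_premeasure_le_measure) auto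
  finally have "ennreal c * (ennreal (inverse c) * hausdorff_premeasure s d (f ` A))
      \<le> ennreal c * hausdorff_measure s A"
    by (intro mult_left_mono) auto
  then show "hausdorff_premeasure s d (f ` A) \<le> ennreal (L powr s) * hausdorff_measure s A"
    by (simp only: cancel c_def[symmetric])
qed

text \<open>A covering set of diameter below \<open>r\<close> cannot meet both \<open>A\<close> and
  \<open>B\<close>, so every fine cover of the union splits into a cover of \<open>A\<close> and one
  of \<open>B\<close>.\<close>

lemma hausdorff_measure_Un_separated:
  assumes "0 < r" and sep: "\<And>a b. a \<in> A \<Longrightarrow> b \<in> B \<Longrightarrow> r \<le> dist a b"
  shows "hausdorff_measure s A + hausdorff_measure s B \<le> hausdorff_measure s (A \<union> B)"
proof -
  have pre: "hausdorff_premeasure s d A + hausdorff_premeasure s d B \<le> hausdorff_premeasure s d (A \<union> B)"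
    if d: "0 < d" "d < r" for d
  proof (rule hausdorff_premeasure_greatest)
    fix E :: "nat \<Rightarrow> 'a set"
    assume cov: "A \<union> B \<subseteq> (\<Union>i. E i)" and bE: "\<And>i. bounded (E i)" and dE: "\<And>i. diameter (E i) \<le> d"
    let ?EA = "\<lambda>i. if E i \<inter> A = {} then {} else E i"
    let ?EB = "\<lambda>i. if E i \<inter> B = {} then {} else E i"
    have disj: "E i \<inter> A = {} \<or> E i \<inter> B = {}" for i
    proof (rule ccontr)
      assume "\<not> ?thesis"
      then obtain a b where "a \<in> E i" "a \<in> A" "b \<in> E i" "b \<in> B" by blast
      then have "r \<le> diameter (E i)"
        using sep diameter_bounded_bound[OF bE] by (meson order_trans)
      then show False using dE[of i] d by simp
    qed
    have "A \<subseteq> (\<Union>i. ?EA i)" "B \<subseteq> (\<Union>i. ?EB i)" using cov by fastforce+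
    then have "hausdorff_premeasure s d A + hausdorff_premeasure s d B
        \<le> (\<Sum>i. ennreal (hausdorff_gauge s (?EA i))) + (\<Sum>i. ennreal (hausdorff_gauge s (?EB i)))"
      using bE dE d by (intro add_mono hausdorff_premeasure_le) auto
    also have "\<dots> = (\<Sum>i. ennreal (hausdorff_gauge s (?EA i)) + ennreal (hausdorff_gauge s (?EB i)))"
      by (intro suminf_add) auto
    also have "\<dots> \<le> (\<Sum>i. ennreal (hausdorff_gauge s (E i)))"
      using disj by (intro suminf_le) auto
    finally show "hausdorff_premeasure s d A + hausdorff_premeasure s d B
        \<le> (\<Sum>i. ennreal (hausdorff_gauge s (E i)))" .
  qed
  \<comment> \<open>The two suprema run over independent scales \<open>d\<close> and
    \<open>d'\<close>; antimonotonicity reduces both to a common scale below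
    \<open>r\<close>.\<close>
  have "hausdorff_premeasure s d A + hausdorff_premeasure s d' B \<le> hausdorff_measure s (A \<union> B)"
    if "0 < d" "0 < d'" for d d'
  proof -
    define m where "m = min (min d d') (r / 2)"
    have m: "0 < m" "m < r" "m \<le> d" "m \<le> d'" using that \<open>0 < r\<close> by (auto simp: m_def)
    have "hausdorff_premeasure s d A + hausdorff_premeasure s d' B
        \<le> hausdorff_premeasure s m A + hausdorff_premeasure s m B"
      using m by (intro add_mono hausdorff_premeasure_antimono)
    also have "\<dots> \<le> hausdorff_measure s (A \<union> B)"
      using pre[OF m(1,2)] hausdorff_premeasure_le_measure[OF m(1)] by (rule order_trans)
    finally show ?thesis .
  qed
  then have "hausdorff_premeasure s d A + hausdorff_measure s B \<le> hausdorff_measure s (A \<union> B)"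
    if "0 < d" for d
    unfolding hausdorff_measure_def[of s B] using that
    by (subst ennreal_SUP_add_right) (auto intro!: SUP_least)
  then show ?thesis
    unfolding hausdorff_measure_def[of s A]
    by (subst add.commute, subst ennreal_SUP_add_right) (auto intro!: SUP_least simp: add.commute)
qed

text \<open>Caratheodory's criterion: annuli \<open>R i\<close>, \<open>R j\<close> around \<open>C\<close> with \<open>i + 2 \<le> j\<close> are separated, so the measures of
  the even and of the odd annuli have finite sums, and the tail close to \<open>C\<close> is negligible.\<close>

lemma hausdorff_measure_Int_Diff_closed:
  assumes "closed C" and fin: "hausdorff_measure s A < top"
  shows "hausdorff_measure s (A \<inter> C) + hausdorff_measure s (A - C) \<le> hausdorff_measure s A"
\<comment> \<open>By convention the distance to the empty set is 0, hence the case split.\<close>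
proof (cases "C = {}")
  case False
  define H :: "'a set \<Rightarrow> ennreal" where "H = hausdorff_measure s"
  define R where "R j = {x \<in> A. 1 / real (j + 2) \<le> infdist x C \<and> infdist x C < 1 / real (j + 1)}" for j
  \<comment> \<open>Points at distance 1 or more from \<open>C\<close> lie in no annulus but in
    every \<open>D k\<close>.\<close>
  define D where "D k = {x \<in> A. 1 / real (k + 1) \<le> infdist x C}" for k :: nat
  have H_fin: "H A < top" using fin by (simp add: H_def)
  \<comment> \<open>Used with \<open>c = 0\<close> for the even and \<open>c = 1\<close> for the odd
    annuli.\<close>
  have half: "(\<Sum>j<m. H (R (2 * j + c))) \<le> H (\<Union>j<m. R (2 * j + c))" for m c :: nat
  proof (induction m)
    case (Suc m)
    show ?case
    proof (cases "m = 0")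
      case False
      \<comment> \<open>The gap between the inner radius of the annulus \<open>2 * m + c - 2\<close>
        and the outer radius of the annulus \<open>2 * m + c\<close>. For \<open>m = c = 0\<close>
        the first term would be the default value \<open>1 / 0 = 0\<close>, so \<open>m = 0\<close>
        is split off.\<close>
      define r where "r = 1 / real (2 * m + c) - 1 / real (2 * m + c + 1)"
      have "0 < r" using False by (simp add: r_def frac_less2)
      have sep: "r \<le> dist x y" if "x \<in> (\<Union>j<m. R (2 * j + c))" "y \<in> R (2 * m + c)" for x y
      proof -
        from that(1) obtain j where "j < m" "x \<in> R (2 * j + c)" by auto
        then have "1 / real (2 * j + c + 2) \<le> infdist x C" by (simp add: R_def)
        moreover have "1 / real (2 * m + c) \<le> 1 / real (2 * j + c + 2)"
          using \<open>j < m\<close> by (intro divide_left_mono) auto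
        moreover have "infdist y C < 1 / real (2 * m + c + 1)" using that(2) by (simp add: R_def)
        ultimately show ?thesis
          using infdist_triangle[of x C y] by (simp add: r_def)
      qed
      have "(\<Sum>j<Suc m. H (R (2 * j + c))) \<le> H (\<Union>j<m. R (2 * j + c)) + H (R (2 * m + c))"
        using Suc.IH by (simp add: add_right_mono)
      also have "\<dots> \<le> H ((\<Union>j<m. R (2 * j + c)) \<union> R (2 * m + c))"
        unfolding H_def using \<open>0 < r\<close> sep by (rule hausdorff_measure_Un_separated)
      also have "(\<Union>j<m. R (2 * j + c)) \<union> R (2 * m + c) = (\<Union>j<Suc m. R (2 * j + c))"
        by (simp add: lessThan_Suc Un_commute)
      finally show ?thesis .
    qed (simp add: lessThan_Suc)
  qed (simp add: H_def)
  have half_A: "(\<Sum>j<m. H (R (2 * j + c))) \<le> H A" for m c :: nat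
  proof -
    have "H (\<Union>j<m. R (2 * j + c)) \<le> H A"
      unfolding H_def by (rule hausdorff_measure_mono) (auto simp: R_def)
    with half show ?thesis by (rule order_trans)
  qed
  have partial: "(\<Sum>j<n. H (R j)) \<le> H A + H A" for n
  proof -
    have "(\<Sum>j<n. H (R j)) \<le> (\<Sum>j<2 * n. H (R j))"
      by (intro sum_mono2) auto
    also have "\<dots> = (\<Sum>j<n. H (R (2 * j + 0))) + (\<Sum>j<n. H (R (2 * j + 1)))"
      by (induction n) (simp_all add: ac_simps)
    also have "\<dots> \<le> H A + H A"
      by (intro add_mono half_A)
    finally show ?thesis .
  qed
  define S where "S = (\<Sum>j. H (R j))"
  have "S \<le> H A + H A"
    unfolding S_def by (intro suminf_le_const partial) auto
  then have S_fin: "S < top"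
    using H_fin by (metis ennreal_add_less_top order_le_less_trans)
  have cover: "A - C \<subseteq> D k \<union> (\<Union>j. R (j + k))" for k
  proof
    fix x assume x: "x \<in> A - C"
    define t where "t = infdist x C"
    have "0 < t" unfolding t_def using x \<open>closed C\<close> False by (simp add: infdist_pos_not_in_closed)
    show "x \<in> D k \<union> (\<Union>j. R (j + k))"
    proof (cases "1 / real (k + 1) \<le> t")
      case True
      then show ?thesis using x by (simp add: D_def t_def)
    next
      case small: False
      \<comment> \<open>The index of the annulus of \<open>x\<close>: minimality gives
        \<open>t < 1 / (j + 1)\<close>, and for \<open>j = 0\<close> this comes from
        \<open>t < 1 / (k + 1) \<le> 1\<close>.\<close>
      define j where "j = (LEAST j. 1 / real (j + 2) \<le> t)"
      obtain n where "n > 0" "inverse (real n) < t" using \<open>0 < t\<close> ex_inverse_of_nat_less by blast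
      moreover have "1 / real (n + 2) \<le> inverse (real n)"
        using \<open>n > 0\<close> by (simp add: field_simps)
      ultimately have "1 / real (n + 2) \<le> t" by linarith
      then have j: "1 / real (j + 2) \<le> t" unfolding j_def by (rule LeastI)
      have "t < 1 / real (j + 1)"
      proof (cases j)
        case 0
        have "1 / real (k + 1) \<le> 1" by (simp add: field_simps)
        then have "t < 1" using small by linarith
        then show ?thesis using 0 by simp
      next
        case (Suc i)
        then have "\<not> 1 / real (i + 2) \<le> t" unfolding j_def by (intro not_less_Least) simp
        then show ?thesis using Suc by simp
      qed
      moreover have "k \<le> j"
      proof -
        have "1 / real (j + 2) < 1 / real (k + 1)" using j small by linarith
        then have "real (k + 1) < real (j + 2)" by (simp add: field_simps)
        then show ?thesis by linarith
      qed
      ultimately have "x \<in> R ((j - k) + k)" using x j by (simp add: R_def t_def)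
      then show ?thesis by blast
    qed
  qed
  \<comment> \<open>The partial sum is added on the left so that on the right the tail of the series
    is completed to \<open>S\<close>. As \<open>k\<close> grows the partial sum tends to
    \<open>S\<close>, and \<open>S\<close> cancels because it is finite.\<close>
  have bound: "(\<Sum>j<k. H (R j)) + (H (A \<inter> C) + H (A - C)) \<le> S + H A" for k
  proof -
    have "H (A \<inter> C) + H (D k) \<le> H ((A \<inter> C) \<union> D k)"
      unfolding H_def
    proof (rule hausdorff_measure_Un_separated)
      fix a b assume ab: "a \<in> A \<inter> C" "b \<in> D k"
      then have "infdist b C \<le> dist a b" by (metis IntD2 dist_commute infdist_le)
      then show "1 / real (k + 1) \<le> dist a b" using ab by (simp add: D_def)
    qed simp
    also have "\<dots> \<le> H A"
      unfolding H_def by (rule hausdorff_measure_mono) (auto simp: D_def)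
    finally have near: "H (A \<inter> C) + H (D k) \<le> H A" .
    have "H (A - C) \<le> H (D k \<union> (\<Union>j. R (j + k)))"
      unfolding H_def by (rule hausdorff_measure_mono[OF cover])
    also have "\<dots> \<le> H (D k) + H (\<Union>j. R (j + k))"
      unfolding H_def by (rule hausdorff_measure_Un)
    also have "\<dots> \<le> H (D k) + (\<Sum>j. H (R (j + k)))"
      unfolding H_def by (intro add_left_mono hausdorff_measure_subadditive order_refl)
    finally have "(\<Sum>j<k. H (R j)) + (H (A \<inter> C) + H (A - C))
        \<le> (\<Sum>j<k. H (R j)) + (H (A \<inter> C) + (H (D k) + (\<Sum>j. H (R (j + k)))))"
      by (intro add_left_mono)
    also have "\<dots> = S + (H (A \<inter> C) + H (D k))"
      unfolding S_def by (subst (2) suminf_offset[of _ k]) (simp_all add: ac_simps)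
    also have "\<dots> \<le> S + H A"
      using near by (rule add_left_mono)
    finally show ?thesis .
  qed
  have "(\<lambda>k. (\<Sum>j<k. H (R j)) + (H (A \<inter> C) + H (A - C))) \<longlonglongrightarrow> S + (H (A \<inter> C) + H (A - C))"
    unfolding S_def by (intro tendsto_add tendsto_const summable_LIMSEQ) simp
  then have "S + (H (A \<inter> C) + H (A - C)) \<le> S + H A"
    by (rule LIMSEQ_le_const2) (use bound in blast)
  then show ?thesis
    using S_fin by (auto simp: H_def ennreal_add_left_cancel_le)
qed simp

section \<open>Finiteness of the measure of a box boundary\<close>

lemma grid_interval:
  fixes l t :: real
  assumes "0 \<le> t" "t \<le> l" "0 < N"
  obtains k where "k < N" "l * (real k / real N) \<le> t" "t \<le> l * (real (k + 1) / real N)"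
proof -
  \<comment> \<open>The index \<open>N - 1\<close> is always admissible, so a least one exists;
    minimality puts the left end of its cell at or below \<open>t\<close>.\<close>
  define k where "k = (LEAST k. t \<le> l * (real (k + 1) / real N))"
  have last: "t \<le> l * (real ((N - 1) + 1) / real N)" using assms by simp
  then have "t \<le> l * (real (k + 1) / real N)" unfolding k_def by (rule LeastI)
  moreover have "k \<le> N - 1" unfolding k_def using last by (rule Least_le)
  then have "k < N" using \<open>0 < N\<close> by simp
  moreover have "l * (real k / real N) \<le> t"
  proof (cases k)
    case (Suc i)
    then have "\<not> t \<le> l * (real (i + 1) / real N)" unfolding k_def by (intro not_less_Least) simp
    then show ?thesis using Suc by simp
  qed (use assms in simp)
  ultimately show ?thesis using that by blast
qed

text \<open>Each of the \<open>2 n\<close> faces is cut into \<open>N^(n-1)\<close> cells of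
  diameter at most \<open>D / N\<close>. The total gauge is of the order
  \<open>N^(n-1) * (D / N)^(n-1)\<close>, which does not depend on \<open>N\<close>.\<close>

lemma hausdorff_measure_frontier_cbox_finite:
  fixes a b :: "'a::euclidean_space"
  shows "hausdorff_measure (real DIM('a) - 1) (frontier (cbox a b)) < top"
proof (cases "cbox a b = {}")
  case True
  then show ?thesis by simp
next
  case False
  then have ab: "a \<bullet> j \<le> b \<bullet> j" if "j \<in> Basis" for j
    using that by (simp add: box_ne_empty)
  define s where "s = real DIM('a) - 1"
  have "1 \<le> DIM('a)" by (simp add: Suc_leI)
  then have "0 \<le> s" by (simp add: s_def)
  \<comment> \<open>The sum of the edge lengths bounds distances through the l1 norm; the summand 1
    keeps \<open>D\<close> positive for degenerate boxes.\<close>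
  define D where "D = (\<Sum>j\<in>Basis. b \<bullet> j - a \<bullet> j) + 1"
  have "0 < D" unfolding D_def using ab by (intro add_nonneg_pos sum_nonneg) auto
  define M where "M = real (2 * DIM('a)) * (unit_ball_vol s * (D / 2) powr s)"
  have "hausdorff_premeasure s d (frontier (cbox a b)) \<le> ennreal M" if "0 < d" for d
  proof -
    obtain N :: nat where "D / d < real N" using reals_Archimedean2 by blast
    moreover from this have N: "0 < N" using \<open>0 < D\<close> \<open>0 < d\<close>
      by (metis divide_pos_pos of_nat_0_less_iff order_less_trans)
    ultimately have DN: "D / real N \<le> d" using \<open>0 < d\<close> by (simp add: field_simps)
    \<comment> \<open>A cell of a face: coordinate \<open>i\<close> is frozen at \<open>c\<close>,
      and \<open>k j\<close> numbers the subinterval for the coordinate \<open>j\<close>.\<close>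
    define P where "P = (\<lambda>(i, c, k). {x. x \<bullet> i = c \<and> (\<forall>j\<in>Basis - {i}.
        a \<bullet> j + (b \<bullet> j - a \<bullet> j) * (real (k j) / real N) \<le> x \<bullet> j \<and>
        x \<bullet> j \<le> a \<bullet> j + (b \<bullet> j - a \<bullet> j) * (real (k j + 1) / real N))})"
    define I where "I = (SIGMA i:(Basis::'a set). {a \<bullet> i, b \<bullet> i} \<times> (\<Pi>\<^sub>E j\<in>Basis - {i}. {..<N}))"
    have "finite I" unfolding I_def by (intro finite_SigmaI finite_cartesian_product finite_PiE) auto
    have "card I = (\<Sum>i\<in>(Basis::'a set). card {a \<bullet> i, b \<bullet> i} * N ^ (DIM('a) - 1))"
      unfolding I_def by (subst card_SigmaI) (auto simp: card_cartesian_product card_PiE intro!: finite_PiE)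
    also have "\<dots> \<le> (\<Sum>i\<in>(Basis::'a set). 2 * N ^ (DIM('a) - 1))"
      by (intro sum_mono mult_right_mono) (auto simp: card_insert_if)
    finally have card: "card I \<le> 2 * DIM('a) * N ^ (DIM('a) - 1)" by simp
    have cover: "frontier (cbox a b) \<subseteq> (\<Union>p\<in>I. P p)"
    proof
      fix x assume "x \<in> frontier (cbox a b)"
      then have x: "x \<in> cbox a b" "x \<notin> box a b" by (auto simp: frontier_cbox)
      then obtain i where i: "i \<in> Basis" "x \<bullet> i \<in> {a \<bullet> i, b \<bullet> i}"
        by (force simp: mem_box)
      have "\<exists>k<N. a \<bullet> j + (b \<bullet> j - a \<bullet> j) * (real k / real N) \<le> x \<bullet> j \<and>
          x \<bullet> j \<le> a \<bullet> j + (b \<bullet> j - a \<bullet> j) * (real (k + 1) / real N)" if "j \<in> Basis" for j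
        using grid_interval[of "x \<bullet> j - a \<bullet> j" "b \<bullet> j - a \<bullet> j" N] x(1) that N
        by (smt (verit) mem_box(2))
      then obtain k where k: "\<And>j. j \<in> Basis \<Longrightarrow> k j < N"
        "\<And>j. j \<in> Basis \<Longrightarrow> a \<bullet> j + (b \<bullet> j - a \<bullet> j) * (real (k j) / real N) \<le> x \<bullet> j"
        "\<And>j. j \<in> Basis \<Longrightarrow> x \<bullet> j \<le> a \<bullet> j + (b \<bullet> j - a \<bullet> j) * (real (k j + 1) / real N)"
        by metis
      have "(i, x \<bullet> i, restrict k (Basis - {i})) \<in> I" using i k(1) by (auto simp: I_def)
      moreover have "x \<in> P (i, x \<bullet> i, restrict k (Basis - {i}))" using k(2,3) by (simp add: P_def)
      ultimately show "x \<in> (\<Union>p\<in>I. P p)" by blast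
    qed
    have dist: "norm (x - y) \<le> D / real N" if "p \<in> I" "x \<in> P p" "y \<in> P p" for p x y
    proof -
      obtain i c k where p: "p = (i, c, k)" by (cases p)
      have "\<bar>(x - y) \<bullet> j\<bar> \<le> (b \<bullet> j - a \<bullet> j) / real N" if "j \<in> Basis" for j
      proof (cases "j = i")
        case True
        then show ?thesis using \<open>x \<in> P p\<close> \<open>y \<in> P p\<close> ab[OF that]
          by (simp add: p P_def inner_diff_left)
      next
        case False
        define l where "l = b \<bullet> j - a \<bullet> j"
        have "l * (real (k j + 1) / real N) = l * (real (k j) / real N) + l / real N"
          by (simp add: add_divide_distrib distrib_left)
        moreover have "a \<bullet> j + l * (real (k j) / real N) \<le> x \<bullet> j"
          "x \<bullet> j \<le> a \<bullet> j + l * (real (k j + 1) / real N)"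
          "a \<bullet> j + l * (real (k j) / real N) \<le> y \<bullet> j"
          "y \<bullet> j \<le> a \<bullet> j + l * (real (k j + 1) / real N)"
          using \<open>x \<in> P p\<close> \<open>y \<in> P p\<close> that False by (auto simp: p P_def l_def)
        ultimately show ?thesis unfolding inner_diff_left l_def[symmetric] by linarith
      qed
      then have "norm (x - y) \<le> (\<Sum>j\<in>Basis. (b \<bullet> j - a \<bullet> j) / real N)"
        by (intro order_trans[OF norm_le_l1] sum_mono)
      also have "\<dots> \<le> D / real N"
        using N by (simp add: D_def sum_divide_distrib[symmetric] divide_right_mono)
      finally show ?thesis .
    qed
    have bdd: "bounded (P p)" if "p \<in> I" for p
      using dist[OF that] by (auto simp: bounded_two_points dist_norm)
    have diam: "diameter (P p) \<le> D / real N" if "p \<in> I" for p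
      using dist[OF that] \<open>0 < D\<close> by (intro diameter_le) auto
    define g where "g = unit_ball_vol s * (D / 2 / real N) powr s"
    have "0 \<le> g" using \<open>0 \<le> s\<close> by (simp add: g_def)
    have piece: "hausdorff_premeasure s d (P p) \<le> ennreal g" if "p \<in> I" for p
    proof -
      have "hausdorff_premeasure s d (P p) \<le> ennreal (hausdorff_gauge s (P p))"
        using bdd[OF that] diam[OF that] DN \<open>0 < d\<close> by (intro hausdorff_premeasure_single) auto
      also have "\<dots> \<le> ennreal g"
        unfolding g_def using \<open>0 \<le> s\<close> \<open>0 < D\<close> N bdd[OF that] diam[OF that]
        by (intro ennreal_leI hausdorff_gauge_le) auto
      finally show ?thesis .
    qed
    have "hausdorff_premeasure s d (frontier (cbox a b)) \<le> hausdorff_premeasure s d (\<Union>p\<in>I. P p)"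
      by (rule hausdorff_premeasure_mono[OF cover])
    also have "\<dots> \<le> (\<Sum>p\<in>I. hausdorff_premeasure s d (P p))"
      using \<open>finite I\<close> \<open>0 < d\<close> by (intro hausdorff_premeasure_finite_Union) auto
    also have "\<dots> \<le> (\<Sum>p\<in>I. ennreal g)"
      by (intro sum_mono piece)
    also have "\<dots> = ennreal (real (card I) * g)"
      using \<open>0 \<le> g\<close> by (simp add: ennreal_mult ennreal_of_nat_eq_real_of_nat)
    also have "\<dots> \<le> ennreal M"
    proof (rule ennreal_leI)
      have "real (card I) * g \<le> real (2 * DIM('a) * N ^ (DIM('a) - 1)) * g"
        using card \<open>0 \<le> g\<close> by (intro mult_right_mono) (auto simp del: of_nat_mult of_nat_power)
      \<comment> \<open>The factor \<open>real N powr s\<close> is the number of cells per face; it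
        cancels the division by \<open>N\<close> inside \<open>g\<close>.\<close>
      also have "\<dots> = real (2 * DIM('a)) * (real N powr s * g)"
        using N \<open>1 \<le> DIM('a)\<close> by (simp add: s_def powr_realpow[symmetric] of_nat_diff)
      also have "real N powr s * g = unit_ball_vol s * (D / 2) powr s"
        using N \<open>0 < D\<close> powr_divide[of "D / 2" "real N" s] by (simp add: g_def)
      finally show "real (card I) * g \<le> M" by (simp add: M_def)
    qed
    finally show ?thesis .
  qed
  then have "hausdorff_measure s (frontier (cbox a b)) \<le> ennreal M"
    by (rule hausdorff_measure_least)
  then show ?thesis
    unfolding s_def by (rule order_le_less_trans) simp
qed

section \<open>Boundaries of nested convex sets\<close>

text \<open>A convex set without interior lies in a hyperplane, whose normal serves at every point.
  Otherwise interior and relative interior agree, and a supporting hyperplane at a relative boundary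
  point is available.\<close>

lemma frontier_supporting_hyperplane:
  fixes A :: "'a::euclidean_space set"
  assumes "convex A" "closed A" "w \<in> frontier A"
  obtains u where "u \<noteq> 0" "\<And>a. a \<in> A \<Longrightarrow> u \<bullet> a \<le> u \<bullet> w"
proof -
  have w: "w \<in> A" "w \<notin> interior A"
    using assms(2,3) by (auto simp: frontier_def)
  show thesis
  proof (cases "interior A = {}")
    case True
    then obtain u b where u: "u \<noteq> 0" "A \<subseteq> {x. u \<bullet> x = b}"
      using empty_interior_subset_hyperplane[OF \<open>convex A\<close>] by blast
    then have "u \<bullet> a = b" if "a \<in> A" for a using that by blast
    then show ?thesis using that[OF u(1)] w(1) by simp
  next
    case False
    then have "w \<notin> rel_interior A" using w by (simp add: rel_interior_nonempty_interior)
    from supporting_hyperplane_rel_boundary[OF \<open>convex A\<close> w(1) this]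
    obtain u where "u \<noteq> 0" "\<And>y. y \<in> A \<Longrightarrow> u \<bullet> w \<le> u \<bullet> y" by metis
    then show ?thesis using that[of "- u"] by simp
  qed
qed

text \<open>The outer normal ray at \<open>w\<close> leaves \<open>B\<close> in a point that projects back to \<open>w\<close>.\<close>

lemma frontier_subset_closest_point_image:
  fixes A B :: "'a::euclidean_space set"
  assumes "convex A" "closed A" "A \<subseteq> B" "bounded B"
  shows "frontier A \<subseteq> closest_point A ` frontier B"
proof
  fix w assume w: "w \<in> frontier A"
  then have "w \<in> A" using \<open>closed A\<close> by (auto simp: frontier_def)
  show "w \<in> closest_point A ` frontier B"
  proof (cases "w \<in> frontier B")
    case True
    then show ?thesis using closest_point_self[OF \<open>w \<in> A\<close>] by (metis imageI)
  next
    case False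
    then have int: "w \<in> interior B"
      using \<open>w \<in> A\<close> \<open>A \<subseteq> B\<close> closure_subset by (auto simp: frontier_def)
    obtain u where u: "u \<noteq> 0" "\<And>a. a \<in> A \<Longrightarrow> u \<bullet> a \<le> u \<bullet> w"
      using frontier_supporting_hyperplane[OF assms(1,2) w] by blast
    obtain d where d: "0 < d" "w + d *\<^sub>R u \<in> frontier B"
      using ray_to_frontier[OF \<open>bounded B\<close> int u(1)] by blast
    \<comment> \<open>In the expanded square the mixed term is nonnegative because \<open>u\<close>
      supports \<open>A\<close> at \<open>w\<close>, so no point of \<open>A\<close> is nearer than
      \<open>w\<close>.\<close>
    have "dist (w + d *\<^sub>R u) w \<le> dist (w + d *\<^sub>R u) z" if "z \<in> A" for z
    proof -
      have "0 \<le> d * (u \<bullet> (w - z))" using d u(2)[OF that] by (simp add: inner_diff_right)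
      moreover have "(w + d *\<^sub>R u - z) \<bullet> (w + d *\<^sub>R u - z)
          = (w - z) \<bullet> (w - z) + 2 * (d * (u \<bullet> (w - z))) + (d *\<^sub>R u) \<bullet> (d *\<^sub>R u)"
        by (simp add: inner_add inner_diff inner_commute algebra_simps)
      ultimately have "(d *\<^sub>R u) \<bullet> (d *\<^sub>R u) \<le> (w + d *\<^sub>R u - z) \<bullet> (w + d *\<^sub>R u - z)"
        using inner_ge_zero[of "w - z"] by linarith
      then have "norm (d *\<^sub>R u) \<le> norm (w + d *\<^sub>R u - z)" unfolding norm_le .
      then show ?thesis by (simp add: dist_norm)
    qed
    then have "w = closest_point A (w + d *\<^sub>R u)"
      using closest_point_unique[OF assms(1,2) \<open>w \<in> A\<close>] by blast
    then show ?thesis using d(2) by blast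
  qed
qed

text \<open>A preimage in \<open>A\<close> would be fixed by the projection, and then
  \<open>w\<close> itself would lie on \<open>frontier B\<close>.\<close>

lemma frontier_diff_subset_closest_point_image:
  fixes A B :: "'a::euclidean_space set"
  assumes "convex A" "closed A" "A \<subseteq> B" "bounded B"
  shows "frontier A - frontier B \<subseteq> closest_point A ` (frontier B - A)"
proof
  fix w assume w: "w \<in> frontier A - frontier B"
  then obtain x where x: "x \<in> frontier B" "w = closest_point A x"
    using frontier_subset_closest_point_image[OF assms] by blast
  then have "x \<notin> A" using w closest_point_self by force
  then show "w \<in> closest_point A ` (frontier B - A)" using x by blast
qed

lemma hausdorff_measure_closest_point_image:
  fixes A S :: "'a::euclidean_space set"
  assumes "0 \<le> s" "convex A" "closed A" "A \<noteq> {}"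
  shows "hausdorff_measure s (closest_point A ` S) \<le> hausdorff_measure s S"
proof -
  have "1-lipschitz_on S (closest_point A)"
    using closest_point_lipschitz[OF assms(2-4)] by (intro lipschitz_onI) auto
  from hausdorff_measure_lipschitz_image[OF \<open>0 \<le> s\<close> _ this] show ?thesis by simp
qed

text \<open>The classical monotonicity of surface area: the 1-Lipschitz projection onto
  \<open>A\<close> maps \<open>frontier B\<close> over all of \<open>frontier A\<close>.\<close>

lemma hausdorff_measure_frontier_mono:
  fixes A B :: "'a::euclidean_space set"
  assumes "0 \<le> s" "convex A" "closed A" "A \<subseteq> B" "bounded B"
  shows "hausdorff_measure s (frontier A) \<le> hausdorff_measure s (frontier B)"
proof (cases "A = {}")
  case False
  have "hausdorff_measure s (frontier A) \<le> hausdorff_measure s (closest_point A ` frontier B)"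
    using assms by (intro hausdorff_measure_mono frontier_subset_closest_point_image)
  also have "\<dots> \<le> hausdorff_measure s (frontier B)"
    using assms False by (intro hausdorff_measure_closest_point_image)
  finally show ?thesis .
qed simp

text \<open>By monotonicity, comparing with an enclosing box.\<close>

lemma hausdorff_measure_frontier_finite:
  fixes K :: "'a::euclidean_space set"
  assumes "convex K" "compact K"
  shows "hausdorff_measure (real DIM('a) - 1) (frontier K) < top"
proof -
  obtain a where "K \<subseteq> cbox (- a) a"
    using bounded_subset_cbox_symmetric compact_imp_bounded[OF \<open>compact K\<close>] by blast
  moreover have "0 \<le> real DIM('a) - 1" by (simp add: Suc_leI)
  ultimately have "hausdorff_measure (real DIM('a) - 1) (frontier K)
      \<le> hausdorff_measure (real DIM('a) - 1) (frontier (cbox (- a) a))"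
    using assms by (intro hausdorff_measure_frontier_mono) (auto intro: compact_imp_closed)
  then show ?thesis
    using hausdorff_measure_frontier_cbox_finite by (rule order_le_less_trans)
qed

section \<open>Inner parallel bodies and shrunk copies of the body\<close>

lemma frontier_affinity:
  fixes S :: "'a::real_normed_vector set"
  assumes "m \<noteq> 0"
  shows "frontier ((\<lambda>x. m *\<^sub>R x + c) ` S) = (\<lambda>x. m *\<^sub>R x + c) ` frontier S"
proof -
  have "homeomorphism UNIV UNIV (\<lambda>x. m *\<^sub>R x + c) (\<lambda>y. (y - c) /\<^sub>R m)"
    using assms by (intro homeomorphismI continuous_intros) auto
  then have "homeomorphic_map euclidean euclidean (\<lambda>x. m *\<^sub>R x + c)"
    by (auto simp: homeomorphic_map_maps homeomorphic_maps_def homeomorphism_def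
        intro!: exI[of _ "\<lambda>y. (y - c) /\<^sub>R m"])
  from homeomorphic_map_frontier_of[OF this, of S] show ?thesis by simp
qed

text \<open>The Minkowski difference of \<open>K\<close> and the closed ball of radius
  \<open>d\<close>, also called erosion.\<close>

definition inner_parallel :: "real \<Rightarrow> 'a::euclidean_space set \<Rightarrow> 'a set" where
  "inner_parallel d K = {x. cball x d \<subseteq> K}"

text \<open>In this form the set is an intersection of translates of \<open>K\<close>, from which
  convexity and closedness are read off.\<close>

lemma inner_parallel_alt:
  fixes K :: "'a::euclidean_space set"
  shows "inner_parallel d K = {x. \<forall>w. norm w \<le> d \<longrightarrow> x + w \<in> K}"
proof -
  have "cball x d \<subseteq> K \<longleftrightarrow> (\<forall>w. norm w \<le> d \<longrightarrow> x + w \<in> K)" for x :: 'a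
  proof (intro iffI allI impI subsetI)
    fix w :: 'a assume "cball x d \<subseteq> K" "norm w \<le> d"
    moreover from this have "x + w \<in> cball x d" by (simp add: dist_norm)
    ultimately show "x + w \<in> K" by blast
  next
    fix y assume "\<forall>w. norm w \<le> d \<longrightarrow> x + w \<in> K" "y \<in> cball x d"
    then have "x + (y - x) \<in> K" by (simp only: mem_cball dist_norm norm_minus_commute)
    then show "y \<in> K" by simp
  qed
  then show ?thesis by (simp add: inner_parallel_def)
qed

lemma inner_parallel_subset: "0 \<le> d \<Longrightarrow> inner_parallel d K \<subseteq> K"
  by (auto simp: inner_parallel_def subset_iff)

lemma convex_inner_parallel: "convex K \<Longrightarrow> convex (inner_parallel d K)"
proof (rule convexI)
  fix x y :: 'a and u v :: real
  assume K: "convex K" and uv: "0 \<le> u" "0 \<le> v" "u + v = 1"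
    and xy: "x \<in> inner_parallel d K" "y \<in> inner_parallel d K"
  have "u *\<^sub>R x + v *\<^sub>R y + w \<in> K" if "norm w \<le> d" for w
  proof -
    have "u *\<^sub>R (x + w) + v *\<^sub>R (y + w) \<in> K"
      using xy that uv K by (auto simp: inner_parallel_alt intro!: convexD)
    also have "u *\<^sub>R (x + w) + v *\<^sub>R (y + w) = u *\<^sub>R x + v *\<^sub>R y + (u + v) *\<^sub>R w"
      by (simp add: algebra_simps)
    finally show ?thesis using uv by simp
  qed
  then show "u *\<^sub>R x + v *\<^sub>R y \<in> inner_parallel d K" by (simp add: inner_parallel_alt)
qed

lemma closed_inner_parallel:
  assumes "closed K" shows "closed (inner_parallel d K)"
proof -
  have "inner_parallel d K = (\<Inter>w\<in>cball 0 d. (\<lambda>x. x + w) -` K)"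
    by (auto simp: inner_parallel_alt)
  also have "closed \<dots>"
    using assms by (intro closed_INT ballI continuous_closed_vimage) (auto intro!: continuous_intros)
  finally show ?thesis .
qed

text \<open>A displacement \<open>w\<close> of length at most \<open>d\<close> is absorbed by the
  centre: \<open>(d / r) c + w = (d / r) (c + (r / d) w)\<close>, and \<open>c + (r / d) w\<close>
  still lies in the ball of radius \<open>r\<close>.\<close>

lemma shrunk_body_subset_inner_parallel:
  assumes "convex K" "cball c r \<subseteq> K" "0 < d" "d < r"
  shows "(\<lambda>x. (1 - d / r) *\<^sub>R x + (d / r) *\<^sub>R c) ` K \<subseteq> inner_parallel d K"
proof clarify
  fix x assume "x \<in> K"
  have "(1 - d / r) *\<^sub>R x + (d / r) *\<^sub>R c + w \<in> K" if "norm w \<le> d" for w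
  proof -
    have "norm ((r / d) *\<^sub>R w) \<le> r" using that assms by (simp add: field_simps)
    then have "c + (r / d) *\<^sub>R w \<in> K" using assms(2) by (auto simp: dist_norm)
    then have "(1 - d / r) *\<^sub>R x + (d / r) *\<^sub>R (c + (r / d) *\<^sub>R w) \<in> K"
      using \<open>x \<in> K\<close> assms by (intro convexD) auto
    then show ?thesis using assms by (simp add: algebra_simps)
  qed
  then show "(1 - d / r) *\<^sub>R x + (d / r) *\<^sub>R c \<in> inner_parallel d K"
    by (simp add: inner_parallel_alt)
qed

text \<open>The inverse \<open>g\<close> of the contraction \<open>h\<close> is Lipschitz with
  constant \<open>1 / m\<close>, so the boundary of the shrunk copy has at least
  \<open>m powr s\<close> times the measure of \<open>frontier K\<close>; monotonicity passes this
  on to the inner body.\<close>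

lemma hausdorff_measure_frontier_le_inner_parallel:
  fixes K :: "'a::euclidean_space set"
  assumes "0 \<le> s" "compact K" "convex K" "cball c r \<subseteq> K" "0 < d" "d < r"
  shows "ennreal ((1 - d / r) powr s) * hausdorff_measure s (frontier K)
    \<le> hausdorff_measure s (frontier (inner_parallel d K))"
proof -
  define m where "m = 1 - d / r"
  have "0 < m" using assms by (simp add: m_def field_simps)
  define h where "h x = m *\<^sub>R x + (d / r) *\<^sub>R c" for x
  define g where "g y = (y - (d / r) *\<^sub>R c) /\<^sub>R m" for y
  have gh: "g (h x) = x" for x using \<open>0 < m\<close> by (simp add: g_def h_def)
  have fr: "frontier (h ` K) = h ` frontier K"
    unfolding h_def using \<open>0 < m\<close> by (intro frontier_affinity) simp
  have "frontier K = g ` frontier (h ` K)" by (simp add: fr image_image gh)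
  moreover have "(1 / m)-lipschitz_on (frontier (h ` K)) g"
  proof (rule lipschitz_onI)
    fix x y
    have "g x - g y = (x - y) /\<^sub>R m" by (simp add: g_def algebra_simps)
    then show "dist (g x) (g y) \<le> 1 / m * dist x y"
      using \<open>0 < m\<close> by (simp add: dist_norm divide_inverse)
  qed (use \<open>0 < m\<close> in simp)
  ultimately have "hausdorff_measure s (frontier K)
      \<le> ennreal ((1 / m) powr s) * hausdorff_measure s (frontier (h ` K))"
    using hausdorff_measure_lipschitz_image[OF \<open>0 \<le> s\<close>, of "1 / m" "frontier (h ` K)" g] \<open>0 < m\<close> by simp
  then have "ennreal (m powr s) * hausdorff_measure s (frontier K)
      \<le> ennreal (m powr s) * (ennreal ((1 / m) powr s) * hausdorff_measure s (frontier (h ` K)))"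
    by (intro mult_left_mono) auto
  also have "\<dots> = hausdorff_measure s (frontier (h ` K))"
    using \<open>0 < m\<close> by (simp add: mult.assoc[symmetric] ennreal_mult'[symmetric] powr_mult[symmetric])
  also have "\<dots> \<le> hausdorff_measure s (frontier (inner_parallel d K))"
  proof (rule hausdorff_measure_frontier_mono[OF \<open>0 \<le> s\<close>])
    show "convex (h ` K)"
      unfolding h_def using convex_affinity[OF \<open>convex K\<close>, of "(d / r) *\<^sub>R c" m] by (simp add: add.commute)
    show "closed (h ` K)"
      unfolding h_def using \<open>compact K\<close>
      by (intro compact_imp_closed compact_continuous_image continuous_intros)
    show "h ` K \<subseteq> inner_parallel d K"
      unfolding h_def m_def using assms by (intro shrunk_body_subset_inner_parallel)
    show "bounded (inner_parallel d K)"
      using bounded_subset[OF compact_imp_bounded[OF \<open>compact K\<close>] inner_parallel_subset] assms(5) by simp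
  qed
  finally show ?thesis by (simp add: m_def)
qed

text \<open>The ball of radius \<open>d\<close> about a boundary point \<open>x\<close> of the inner
  body must reach the boundary of \<open>K\<close>, since otherwise compactness leaves room to move
  \<open>x\<close>. The point \<open>y\<close> reached lies in an inner ball and projects to
  \<open>x\<close>.\<close>

lemma frontier_inner_parallel_subset:
  fixes K :: "'a::euclidean_space set"
  assumes "compact K" "convex K" "0 < d"
  shows "frontier (inner_parallel d K)
    \<subseteq> closest_point (inner_parallel d K) ` (frontier K \<inter> union_of_inner_balls d K)"
proof
  let ?A = "inner_parallel d K"
  fix x assume x: "x \<in> frontier ?A"
  have closed: "closed ?A" using assms by (intro closed_inner_parallel compact_imp_closed)
  then have "x \<in> ?A" using x by (auto simp: frontier_def)
  have "\<exists>y\<in>frontier K. dist x y \<le> d"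
  proof (rule ccontr)
    assume "\<not> ?thesis"
    then have "cball x d \<subseteq> interior K"
      using \<open>x \<in> ?A\<close> closure_subset[of K] by (fastforce simp: frontier_def inner_parallel_def)
    then obtain e where e: "0 < e" "(\<Union>z\<in>cball x d. ball z e) \<subseteq> interior K"
      using compact_subset_open_imp_ball_epsilon_subset[OF compact_cball open_interior] by blast
    have "ball x e \<subseteq> ?A"
    proof
      fix x' assume "x' \<in> ball x e"
      have "x' + w \<in> K" if "norm w \<le> d" for w
      proof -
        have "x + w \<in> cball x d" "x' + w \<in> ball (x + w) e"
          using that \<open>x' \<in> ball x e\<close> by (auto simp: dist_norm)
        then show ?thesis using e(2) interior_subset by blast
      qed
      then show "x' \<in> ?A" by (simp add: inner_parallel_alt)
    qed
    then have "x \<in> interior ?A" using \<open>0 < e\<close> by (auto simp: mem_interior)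
    then show False using x by (simp add: frontier_def)
  qed
  then obtain y where y: "y \<in> frontier K" "dist x y \<le> d" by blast
  have "y \<in> union_of_inner_balls d K"
    using y(2) \<open>x \<in> ?A\<close> unfolding union_of_inner_balls_def inner_parallel_def mem_cball[symmetric]
    by blast
  \<comment> \<open>A nearer point \<open>z\<close> would have \<open>y\<close> in its open ball of
    radius \<open>d\<close>, which is contained in the interior of \<open>K\<close>.\<close>
  have "dist y x \<le> dist y z" if "z \<in> ?A" for z
  proof (rule ccontr)
    assume "\<not> ?thesis"
    then have "y \<in> ball z d" using y(2) by (simp add: dist_commute)
    moreover have "ball z d \<subseteq> interior K"
      using that by (intro interior_maximal) (auto simp: inner_parallel_def intro: order_trans[OF ball_subset_cball])
    ultimately show False using y(1) by (auto simp: frontier_def)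
  qed
  then have "x = closest_point ?A y"
    using closest_point_unique[OF convex_inner_parallel[OF \<open>convex K\<close>] closed \<open>x \<in> ?A\<close>] by blast
  then show "x \<in> closest_point ?A ` (frontier K \<inter> union_of_inner_balls d K)"
    using y(1) \<open>y \<in> union_of_inner_balls d K\<close> by blast
qed

section \<open>Regularity of outer parallel bodies\<close>

text \<open>The Minkowski sum with a ball, written as a set of sums so that compactness is that of a
  sum of two compact sets.\<close>

definition parallel_body :: "real \<Rightarrow> 'a::euclidean_space set \<Rightarrow> 'a set" where
  "parallel_body d A = {x + y | x y. x \<in> A \<and> y \<in> cball 0 d}"

lemma mem_parallel_body: "y \<in> parallel_body d A \<longleftrightarrow> (\<exists>a\<in>A. dist a y \<le> d)"
proof
  assume "\<exists>a\<in>A. dist a y \<le> d"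
  then obtain a where "a \<in> A" "dist a y \<le> d" by blast
  then have "y = a + (y - a)" "y - a \<in> cball 0 d" by (auto simp: dist_norm norm_minus_commute)
  with \<open>a \<in> A\<close> show "y \<in> parallel_body d A" unfolding parallel_body_def by blast
qed (force simp: parallel_body_def dist_norm)

text \<open>The regularity proof sees only the inner body \<open>A\<close>; the original body
  \<open>K\<close> does not enter.\<close>

locale convex_parallel =
  fixes A :: "'a::euclidean_space set" and d :: real
  assumes compact: "compact A" and convex: "convex A" and nonempty: "A \<noteq> {}" and d_pos: "0 < d"
begin

abbreviation W :: "'a set" where "W \<equiv> parallel_body d A"

text \<open>On the boundary of \<open>W\<close> this is an outer unit normal. It is defined on the
  whole space, where the projection is 1-Lipschitz.\<close>

definition normal :: "'a \<Rightarrow> 'a" where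
  "normal y = (y - closest_point A y) /\<^sub>R d"

lemma closed_A: "closed A"
  by (rule compact_imp_closed[OF compact])

lemma compact_W: "compact W"
  unfolding parallel_body_def using compact by (rule compact_sums) simp

lemma convex_W: "convex W"
proof -
  have "W = (\<Union>x\<in>A. \<Union>y\<in>cball 0 d. {x + y})" unfolding parallel_body_def by blast
  then show ?thesis using convex_sums[OF convex convex_cball] by simp
qed

lemma ball_subset_interior: "a \<in> A \<Longrightarrow> ball a d \<subseteq> interior W"
  by (rule interior_maximal) (force simp: mem_parallel_body intro: less_imp_le)+

lemma convex_body_W: "convex_body W"
proof -
  obtain a where "a \<in> A" using nonempty by blast
  then have "a \<in> interior W" using ball_subset_interior[of a] d_pos by auto
  then show ?thesis using compact_W convex_W by (auto simp: convex_body_def)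
qed

lemma frontier_subset: "frontier W \<subseteq> W"
  using compact_W by (simp add: compact_imp_closed frontier_subset_closed)

lemma frontier_not_ball: "y \<in> frontier W \<Longrightarrow> a \<in> A \<Longrightarrow> d \<le> dist a y"
  using ball_subset_interior[of a] by (force simp: frontier_def not_less[symmetric])

text \<open>A boundary point \<open>y\<close> has distance exactly \<open>d\<close> from
  \<open>A\<close>, attained at \<open>a\<close>. For the support property write
  \<open>z = b + v\<close> with \<open>b \<in> A\<close> and \<open>norm v \<le> d\<close>: the
  projection gives \<open>normal y \<bullet> (b - a) \<le> 0\<close>, and
  \<open>normal y \<bullet> v \<le> d\<close> is offset by
  \<open>y = a + d * normal y\<close>.\<close>

lemma
  assumes y: "y \<in> frontier W"
  shows norm_normal: "norm (normal y) = 1"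
    and closest_point_frontier: "closest_point A y = y - d *\<^sub>R normal y"
    and normal_support: "z \<in> W \<Longrightarrow> normal y \<bullet> (z - y) \<le> 0"
proof -
  obtain a where a: "a \<in> A" "dist a y \<le> d"
    using y frontier_subset mem_parallel_body by blast
  then have "dist a y = d" using frontier_not_ball[OF y] by fastforce
  then have "\<forall>z\<in>A. dist y a \<le> dist y z"
    using frontier_not_ball[OF y] by (metis dist_commute)
  then have cp: "closest_point A y = a"
    using closest_point_unique[OF convex closed_A a(1)] by simp
  show n: "norm (normal y) = 1"
    using \<open>dist a y = d\<close> d_pos by (simp add: normal_def cp dist_norm norm_minus_commute)
  show ya: "closest_point A y = y - d *\<^sub>R normal y"
    using d_pos by (simp add: normal_def)
  show "normal y \<bullet> (z - y) \<le> 0" if "z \<in> W"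
  proof -
    obtain b where b: "b \<in> A" "dist b z \<le> d" using \<open>z \<in> W\<close> mem_parallel_body by blast
    have "(y - a) \<bullet> (b - a) \<le> 0"
      using closest_point_dot[OF convex closed_A b(1), of y] cp by simp
    moreover have "y - a = d *\<^sub>R normal y" using ya cp by simp
    ultimately have 1: "normal y \<bullet> (b - a) \<le> 0" using d_pos by (simp add: mult_le_0_iff)
    have "normal y \<bullet> (z - b) \<le> norm (normal y) * norm (z - b)" by (rule norm_cauchy_schwarz)
    also have "\<dots> \<le> d" using n b by (simp add: dist_norm norm_minus_commute)
    finally have 2: "normal y \<bullet> (z - b) \<le> d" .
    have "z - y = (z - b) + (b - a) - d *\<^sub>R normal y"
      unfolding \<open>y - a = d *\<^sub>R normal y\<close>[symmetric] by simp
    then have "normal y \<bullet> (z - y) = normal y \<bullet> (z - b) + normal y \<bullet> (b - a) - d * (normal y \<bullet> normal y)"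
      by (simp only: inner_diff_right inner_add_right inner_scaleR_right)
    moreover have "normal y \<bullet> normal y = 1" using n by (simp add: norm_eq_1)
    ultimately show ?thesis using 1 2 by simp
  qed
qed

text \<open>The 2 counts the identity and the projection, each with Lipschitz constant 1.\<close>

lemma normal_lipschitz:
  "norm (normal y - normal z) \<le> 2 / d * norm (y - z)"
proof -
  have "norm (closest_point A y - closest_point A z) \<le> norm (y - z)"
    using closest_point_lipschitz[OF convex closed_A nonempty, of y z] by (simp add: dist_norm)
  then have "norm ((y - z) - (closest_point A y - closest_point A z)) \<le> 2 * norm (y - z)"
    using norm_triangle_ineq4[of "y - z" "closest_point A y - closest_point A z"] by simp
  moreover have "normal y - normal z = ((y - z) - (closest_point A y - closest_point A z)) /\<^sub>R d"
    by (simp add: normal_def algebra_simps)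
  ultimately have "norm (normal y - normal z) \<le> (2 * norm (y - z)) / d"
    using d_pos by (simp add: divide_right_mono flip: divide_inverse_commute)
  then show ?thesis by simp
qed

text \<open>The lower bound expresses that \<open>W\<close> has an inner touching ball of radius \<open>d\<close> at \<open>y\<close>.\<close>

lemma normal_lower:
  assumes y: "y \<in> frontier W" and z: "z \<in> frontier W"
  shows "- (norm (z - y))\<^sup>2 \<le> 2 * d * (normal y \<bullet> (z - y))"
proof -
  have "closest_point A y \<in> A" using closed_A nonempty by (rule closest_point_in_set)
  then have "d \<le> norm (z - y + d *\<^sub>R normal y)"
    using frontier_not_ball[OF z] closest_point_frontier[OF y]
    by (fastforce simp: dist_norm norm_minus_commute algebra_simps)
  then have "d\<^sup>2 \<le> (norm (z - y + d *\<^sub>R normal y))\<^sup>2"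
    using d_pos by (intro power_mono) auto
  also have "\<dots> = (norm (z - y))\<^sup>2 + 2 * d * (normal y \<bullet> (z - y)) + d\<^sup>2 * (norm (normal y))\<^sup>2"
    unfolding power2_norm_eq_inner by (simp add: inner_add inner_commute algebra_simps power2_eq_square)
  finally show ?thesis using norm_normal[OF y] by simp
qed

text \<open>The last axis \<open>u\<close> is the normal at \<open>p\<close>, and the neighbourhood
  \<open>N\<close> is a cylinder over the disc \<open>V\<close>. Convexity makes the boundary a
  graph in \<open>N\<close>; its gradient \<open>g\<close> is read off from the normals and inherits
  their Lipschitz continuity.\<close>

lemma C11_boundary_W: "C11_boundary W"
  unfolding C11_boundary_def
proof
  fix p assume p: "p \<in> frontier W"
  define u where "u = normal p"
  define c where "c = closest_point A p"
  define pr where "pr y = y - (u \<bullet> y) *\<^sub>R u" for y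
  define t0 where "t0 = u \<bullet> p"
  define N where "N = {y. norm (pr y - pr p) < d / 2 \<and> \<bar>u \<bullet> y - t0\<bar> < d}"
  define V where "V = {x. u \<bullet> x = 0 \<and> norm (x - pr p) < d / 2}"
  have nu: "norm u = 1" using norm_normal[OF p] by (simp add: u_def)
  then have uu: "u \<bullet> u = 1" by (simp add: norm_eq_1)
  have "c \<in> A" unfolding c_def using closed_A nonempty by (rule closest_point_in_set)
  have c: "c = p - d *\<^sub>R u" using closest_point_frontier[OF p] by (simp add: c_def u_def)
  have p_decomp: "p = pr p + t0 *\<^sub>R u" by (simp add: pr_def t0_def)
  have pr_V: "pr (x + t *\<^sub>R u) = x" "u \<bullet> (x + t *\<^sub>R u) = t" if "x \<in> V" for x t
    using that uu by (simp_all add: pr_def V_def inner_add_right)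
  \<comment> \<open>The level \<open>t0 - d\<close> is that of \<open>c\<close>, the centre of the
    inner ball touching at \<open>p\<close>. Points over \<open>V\<close> on this level are within
    \<open>d / 2\<close> of \<open>c\<close>, which leaves a margin of \<open>d / 2\<close>.\<close>
  have ball_in_W: "x + (t0 - d) *\<^sub>R u + w \<in> W" if "x \<in> V" "norm w \<le> d / 2" for x w
  proof -
    have "norm (x + (t0 - d) *\<^sub>R u + w - c) = norm ((x - pr p) + w)"
      by (simp add: c pr_def t0_def algebra_simps)
    also have "\<dots> \<le> d"
      using norm_triangle_ineq[of "x - pr p" w] that by (simp add: V_def)
    finally show ?thesis using \<open>c \<in> A\<close> by (auto simp: mem_parallel_body dist_norm norm_minus_commute)
  qed
  have base: "x + (t0 - d) *\<^sub>R u \<in> interior W" if "x \<in> V" for x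
  proof -
    have "cball (x + (t0 - d) *\<^sub>R u) (d / 2) \<subseteq> W"
    proof
      fix y assume "y \<in> cball (x + (t0 - d) *\<^sub>R u) (d / 2)"
      then show "y \<in> W"
        using ball_in_W[OF that, of "y - (x + (t0 - d) *\<^sub>R u)"]
        by (simp add: dist_norm norm_minus_commute)
    qed
    then have "ball (x + (t0 - d) *\<^sub>R u) (d / 2) \<subseteq> interior W"
      by (intro interior_maximal) (auto intro: order_trans[OF ball_subset_cball])
    then show ?thesis using d_pos by auto
  qed
  have below: "u \<bullet> y \<le> t0" if "y \<in> W" for y
    using normal_support[OF p that] by (simp add: u_def t0_def inner_diff_right)
  \<comment> \<open>The vertical segment starts in the interior at level \<open>t0 - d\<close> and
    ends above the supporting hyperplane at \<open>p\<close>, so it crosses the boundary.\<close>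
  have exists: "\<exists>t. \<bar>t - t0\<bar> < d \<and> x + t *\<^sub>R u \<in> frontier W" if x: "x \<in> V" for x
  proof -
    let ?S = "closed_segment (x + (t0 - d) *\<^sub>R u) (x + (t0 + d / 2) *\<^sub>R u)"
    have "x + (t0 + d / 2) *\<^sub>R u \<notin> W"
      using below[of "x + (t0 + d / 2) *\<^sub>R u"] pr_V(2)[OF x, of "t0 + d / 2"] d_pos by auto
    then have "?S \<inter> frontier W \<noteq> {}"
      using base[OF x] interior_subset by (intro connected_Int_frontier) fastforce+
    then obtain s where s: "0 \<le> s" "s \<le> 1"
      and "(1 - s) *\<^sub>R (x + (t0 - d) *\<^sub>R u) + s *\<^sub>R (x + (t0 + d / 2) *\<^sub>R u) \<in> frontier W"
      by (auto simp: closed_segment_def)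
    moreover have "(1 - s) *\<^sub>R (x + (t0 - d) *\<^sub>R u) + s *\<^sub>R (x + (t0 + d / 2) *\<^sub>R u)
        = x + (t0 - d + s * (3 / 2 * d)) *\<^sub>R u"
      by (simp add: algebra_simps flip: scaleR_add_left)
    ultimately have fr: "x + (t0 - d + s * (3 / 2 * d)) *\<^sub>R u \<in> frontier W" by simp
    have "s \<noteq> 0"
    proof
      assume "s = 0"
      then show False using fr base[OF x] by (simp add: frontier_def)
    qed
    then have "0 < s * (3 / 2 * d)" using s d_pos by simp
    moreover have "t0 - d + s * (3 / 2 * d) \<le> t0"
      using below[of "x + (t0 - d + s * (3 / 2 * d)) *\<^sub>R u"] fr frontier_subset pr_V(2)[OF x] by auto
    ultimately show ?thesis
      using fr by (intro exI[of _ "t0 - d + s * (3 / 2 * d)"]) auto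
  qed
  \<comment> \<open>Of two boundary points over \<open>x\<close> the lower one would lie strictly
    between an interior point and a point of the closure, hence in the interior.\<close>
  have not_above: False
    if x: "x \<in> V" and t: "\<bar>t - t0\<bar> < d" "x + t *\<^sub>R u \<in> frontier W" and t': "t < t'" "x + t' *\<^sub>R u \<in> frontier W"
    for x t t'
  proof -
    define s where "s = (t - (t0 - d)) / (t' - (t0 - d))"
    have s: "0 < s" "s < 1" using t t' by (auto simp: s_def)
    have "(1 - s) *\<^sub>R (x + (t0 - d) *\<^sub>R u) + s *\<^sub>R (x + t' *\<^sub>R u)
        = x + ((t0 - d) + s * (t' - (t0 - d))) *\<^sub>R u"
      by (simp add: algebra_simps flip: scaleR_add_left)
    also have "s * (t' - (t0 - d)) = t - (t0 - d)" using t t' by (simp add: s_def)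
    finally have eq: "x + t *\<^sub>R u = (1 - s) *\<^sub>R (x + (t0 - d) *\<^sub>R u) + s *\<^sub>R (x + t' *\<^sub>R u)" by simp
    have "x + (t0 - d) *\<^sub>R u \<noteq> x + t' *\<^sub>R u" using t t' nu by auto
    then have "x + t *\<^sub>R u \<in> open_segment (x + (t0 - d) *\<^sub>R u) (x + t' *\<^sub>R u)"
      using s eq by (auto simp: in_segment)
    moreover have "x + t' *\<^sub>R u \<in> closure W" using t'(2) by (simp add: frontier_def)
    ultimately have "x + t *\<^sub>R u \<in> interior W"
      using in_interior_closure_convex_segment[OF convex_W base[OF x]] by blast
    then show False using t(2) by (simp add: frontier_def)
  qed
  have unique: "t = t'"
    if "x \<in> V" "\<bar>t - t0\<bar> < d" "x + t *\<^sub>R u \<in> frontier W" "\<bar>t' - t0\<bar> < d" "x + t' *\<^sub>R u \<in> frontier W"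
    for x t t'
    using not_above[OF that(1-3) _ that(5)] not_above[OF that(1,4,5) _ that(3)]
    by (meson linorder_neq_iff)
  define f where "f x = (THE t. \<bar>t - t0\<bar> < d \<and> x + t *\<^sub>R u \<in> frontier W)" for x
  have f: "\<bar>f x - t0\<bar> < d" "x + f x *\<^sub>R u \<in> frontier W" if "x \<in> V" for x
  proof -
    have "\<exists>!t. \<bar>t - t0\<bar> < d \<and> x + t *\<^sub>R u \<in> frontier W"
      using exists[OF that] unique[OF that] by blast
    from theI'[OF this] show "\<bar>f x - t0\<bar> < d" "x + f x *\<^sub>R u \<in> frontier W"
      by (auto simp: f_def)
  qed
  have "pr p \<in> V" using uu d_pos by (simp add: V_def pr_def inner_diff_right)
  have graph: "frontier W \<inter> N = (\<lambda>x. x + f x *\<^sub>R u) ` V"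
  proof (intro set_eqI iffI)
    fix y assume y: "y \<in> frontier W \<inter> N"
    have "pr y \<in> V" using y uu by (simp add: V_def N_def pr_def inner_diff_right)
    have eq: "pr y + (u \<bullet> y) *\<^sub>R u = y" by (simp add: pr_def)
    then have "u \<bullet> y = f (pr y)"
      using unique[OF \<open>pr y \<in> V\<close> _ _ f[OF \<open>pr y \<in> V\<close>], of "u \<bullet> y"] y by (simp add: N_def)
    with eq have "y = pr y + f (pr y) *\<^sub>R u" by simp
    then show "y \<in> (\<lambda>x. x + f x *\<^sub>R u) ` V" using \<open>pr y \<in> V\<close> by (rule image_eqI)
  next
    fix y assume "y \<in> (\<lambda>x. x + f x *\<^sub>R u) ` V"
    then obtain x where x: "x \<in> V" "y = x + f x *\<^sub>R u" by blast
    then show "y \<in> frontier W \<inter> N"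
      using f[OF x(1)] pr_V[OF x(1), of "f x"] by (simp add: N_def) (simp add: V_def)
  qed
  define n where "n x = normal (x + f x *\<^sub>R u)" for x
  have norm_n: "norm (n x) = 1" if "x \<in> V" for x
    using norm_normal f(2)[OF that] by (simp add: n_def)
  \<comment> \<open>The support inequality is tested with the point at distance \<open>d / 2\<close>
    from the base point in direction \<open>n x\<close>; the boundary point lies at height
    \<open>t \<le> d\<close> above the base point.\<close>
  have n_u: "1 / 2 \<le> n x \<bullet> u" if x: "x \<in> V" for x
  proof -
    define t where "t = f x - (t0 - d)"
    have t: "0 < t" "t \<le> d"
      using f[OF x] below[of "x + f x *\<^sub>R u"] frontier_subset pr_V(2)[OF x, of "f x"] by (auto simp: t_def)
    have "x + (t0 - d) *\<^sub>R u + (d / 2) *\<^sub>R n x \<in> W"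
      using ball_in_W[OF x] norm_n[OF x] d_pos by simp
    from normal_support[OF f(2)[OF x] this]
    have "n x \<bullet> ((d / 2) *\<^sub>R n x - t *\<^sub>R u) \<le> 0"
      by (simp add: n_def[symmetric] t_def algebra_simps)
    moreover have "n x \<bullet> n x = 1" using norm_n[OF x] by (simp add: norm_eq_1)
    ultimately have 1: "d / 2 \<le> t * (n x \<bullet> u)" by (simp add: inner_diff_right)
    then have "0 < n x \<bullet> u" using t d_pos by (smt (verit) mult_nonneg_nonpos half_gt_zero)
    then have "t * (n x \<bullet> u) \<le> d * (n x \<bullet> u)" using t by (intro mult_right_mono) auto
    with 1 have "d * (1 / 2) \<le> d * (n x \<bullet> u)" by simp
    then show ?thesis using d_pos by simp
  qed
  have upper: "n x \<bullet> (y - x) + (n x \<bullet> u) * (f y - f x) \<le> 0" if "x \<in> V" "y \<in> V" for x y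
    using normal_support[OF f(2)[OF that(1)], of "y + f y *\<^sub>R u"] f(2)[OF that(2)] frontier_subset
    by (auto simp: n_def[symmetric] inner_diff_right inner_add_right algebra_simps)
  \<comment> \<open>The factor 2 is the inverse of the lower bound for
    \<open>n x \<bullet> u\<close>. Exchanging \<open>x\<close> and \<open>y\<close> makes
    \<open>f\<close> 2-Lipschitz, and the graph map gets the constant
    \<open>1 + 2 = 3\<close>.\<close>
  have f_step: "f y - f x \<le> 2 * norm (y - x)" if "x \<in> V" "y \<in> V" for x y
  proof -
    have "\<bar>n x \<bullet> (y - x)\<bar> \<le> norm (y - x)"
      using Cauchy_Schwarz_ineq2[of "n x" "y - x"] norm_n[OF that(1)] by simp
    with upper[OF that] have 1: "(n x \<bullet> u) * (f y - f x) \<le> norm (y - x)" by linarith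
    show ?thesis
    proof (cases "f y \<le> f x")
      case True
      have "0 \<le> 2 * norm (y - x)" by simp
      with True show ?thesis by linarith
    next
      case False
      then have "1 / 2 * (f y - f x) \<le> (n x \<bullet> u) * (f y - f x)"
        using n_u[OF that(1)] by (intro mult_right_mono) auto
      with 1 show ?thesis by simp
    qed
  qed
  have f_lip: "\<bar>f y - f x\<bar> \<le> 2 * norm (y - x)" if "x \<in> V" "y \<in> V" for x y
    using f_step[OF that] f_step[OF that(2,1)] by (simp add: norm_minus_commute)
  have graph_lip: "norm ((y + f y *\<^sub>R u) - (x + f x *\<^sub>R u)) \<le> 3 * norm (y - x)"
    if "x \<in> V" "y \<in> V" for x y
  proof -
    have "(y + f y *\<^sub>R u) - (x + f x *\<^sub>R u) = (y - x) + (f y - f x) *\<^sub>R u"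
      by (simp add: algebra_simps)
    moreover have "norm ((y - x) + (f y - f x) *\<^sub>R u) \<le> norm (y - x) + \<bar>f y - f x\<bar>"
      using norm_triangle_ineq[of "y - x" "(f y - f x) *\<^sub>R u"] nu by simp
    ultimately have "norm ((y + f y *\<^sub>R u) - (x + f x *\<^sub>R u)) \<le> norm (y - x) + \<bar>f y - f x\<bar>"
      by (simp only:)
    with f_lip[OF that] show ?thesis by linarith
  qed
  \<comment> \<open>The tangent hyperplane has slope \<open>- n x / (n x \<bullet> u)\<close>;
    adding \<open>u\<close> makes the vector orthogonal to \<open>u\<close> and changes nothing
    along \<open>V\<close>.\<close>
  define g where "g x = u - n x /\<^sub>R (n x \<bullet> u)" for x
  \<comment> \<open>The linearisation error \<open>e\<close> is at most 0 by the support property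
    and at least \<open>- (3 * norm (y - x))^2 / (2 * d)\<close> by the inner touching ball;
    dividing by \<open>n x \<bullet> u \<ge> 1 / 2\<close> doubles the bound.\<close>
  have taylor: "\<bar>f y - f x - g x \<bullet> (y - x)\<bar> \<le> 9 / d * (norm (y - x))\<^sup>2" if V: "x \<in> V" "y \<in> V" for x y
  proof -
    define e where "e = n x \<bullet> (y - x) + (n x \<bullet> u) * (f y - f x)"
    have pos: "0 < n x \<bullet> u" using n_u[OF V(1)] by linarith
    have "u \<bullet> (y - x) = 0" using V by (simp add: V_def inner_diff_right)
    then have eq: "f y - f x - g x \<bullet> (y - x) = e / (n x \<bullet> u)"
      using pos by (simp add: g_def e_def inner_diff_left field_simps)
    have "e = n x \<bullet> ((y + f y *\<^sub>R u) - (x + f x *\<^sub>R u))"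
      by (simp add: e_def inner_diff_right inner_add_right algebra_simps)
    then have "- (norm ((y + f y *\<^sub>R u) - (x + f x *\<^sub>R u)))\<^sup>2 \<le> 2 * d * e"
      using normal_lower[OF f(2)[OF V(1)] f(2)[OF V(2)]] by (simp add: n_def)
    moreover have "(norm ((y + f y *\<^sub>R u) - (x + f x *\<^sub>R u)))\<^sup>2 \<le> (3 * norm (y - x))\<^sup>2"
      using graph_lip[OF V] by (intro power_mono) auto
    ultimately have "- e \<le> 9 / (2 * d) * (norm (y - x))\<^sup>2"
      using d_pos by (simp add: field_simps power_mult_distrib)
    moreover have "e \<le> 0" using upper[OF V] by (simp add: e_def)
    ultimately have "\<bar>e\<bar> \<le> 9 / (2 * d) * (norm (y - x))\<^sup>2" by simp
    moreover have "\<bar>e\<bar> / (n x \<bullet> u) \<le> \<bar>e\<bar> / (1 / 2)"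
      using n_u[OF V(1)] by (intro divide_left_mono) auto
    ultimately show ?thesis using pos by (simp add: eq)
  qed
  have deriv: "(f has_derivative (\<lambda>h. g x \<bullet> h)) (at x within V)" if x: "x \<in> V" for x
    unfolding has_derivative_within_alt
  proof (intro conjI allI impI)
    show "bounded_linear ((\<bullet>) (g x))" by (rule bounded_linear_inner_right)
    fix e :: real assume "0 < e"
    show "\<exists>r>0. \<forall>y\<in>V. norm (y - x) < r \<longrightarrow> norm (f y - f x - g x \<bullet> (y - x)) \<le> e * norm (y - x)"
    \<comment> \<open>This radius makes \<open>9 / d * norm (y - x)\<close> smaller than
      \<open>e\<close>.\<close>
    proof (intro exI[of _ "e * d / 9"] conjI ballI impI)
      show "0 < e * d / 9" using \<open>0 < e\<close> d_pos by simp
      fix y assume y: "y \<in> V" "norm (y - x) < e * d / 9"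
      have "norm (f y - f x - g x \<bullet> (y - x)) \<le> (9 / d * norm (y - x)) * norm (y - x)"
        using taylor[OF x y(1)] by (simp add: power2_eq_square)
      also have "\<dots> \<le> e * norm (y - x)"
        using y(2) d_pos by (intro mult_right_mono) (auto simp: field_simps)
      finally show "norm (f y - f x - g x \<bullet> (y - x)) \<le> e * norm (y - x)" .
    qed
  qed
  have g_perp: "u \<bullet> g x = 0" if "x \<in> V" for x
    using n_u[OF that] uu by (simp add: g_def inner_diff_right inner_commute)
  have g_lip: "norm (g y - g x) \<le> 36 / d * norm (y - x)" if V: "x \<in> V" "y \<in> V" for x y
  proof -
    define a b where "a = n x \<bullet> u" and "b = n y \<bullet> u"
    have ab: "1 / 2 \<le> a" "1 / 2 \<le> b" using n_u V by (auto simp: a_def b_def)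
    define r where "r = norm (n y - n x)"
    have "\<bar>b - a\<bar> \<le> r"
      using Cauchy_Schwarz_ineq2[of "n y - n x" u] nu by (simp add: a_def b_def r_def inner_diff_left)
    have "r \<le> 2 / d * norm ((y + f y *\<^sub>R u) - (x + f x *\<^sub>R u))"
      unfolding r_def n_def by (rule normal_lipschitz)
    also have "\<dots> \<le> 2 / d * (3 * norm (y - x))"
      using graph_lip[OF V] d_pos by (intro mult_left_mono) auto
    finally have r: "r \<le> 6 / d * norm (y - x)" by simp
    have inv: "\<bar>inverse a\<bar> \<le> 2" "\<bar>inverse b\<bar> \<le> 2" using ab by (auto simp: field_simps)
    have "inverse a - inverse b = (b - a) * (inverse a * inverse b)"
      using ab by (simp add: field_simps)
    then have "\<bar>inverse a - inverse b\<bar> = \<bar>b - a\<bar> * (\<bar>inverse a\<bar> * \<bar>inverse b\<bar>)"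
      by (simp add: abs_mult)
    also have "\<dots> \<le> r * (2 * 2)"
      using inv \<open>\<bar>b - a\<bar> \<le> r\<close> by (intro mult_mono) auto
    finally have inv_diff: "\<bar>inverse a - inverse b\<bar> \<le> 4 * r" by simp
    \<comment> \<open>The term \<open>u\<close> cancels. The two summands contribute
      \<open>4 * r\<close> and \<open>2 * r\<close>, and \<open>r \<le> 6 / d * norm (y - x)\<close>
      gives the constant \<open>36 / d\<close>.\<close>
    have "g y - g x = (inverse a - inverse b) *\<^sub>R n x - inverse b *\<^sub>R (n y - n x)"
      by (simp add: g_def a_def b_def algebra_simps)
    then have "norm (g y - g x) \<le> \<bar>inverse a - inverse b\<bar> * norm (n x) + \<bar>inverse b\<bar> * r"
      using norm_triangle_ineq4[of "(inverse a - inverse b) *\<^sub>R n x" "inverse b *\<^sub>R (n y - n x)"]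
      by (simp add: r_def)
    also have "\<dots> \<le> 4 * r + 2 * r"
      using inv_diff inv norm_n[OF V(1)] by (intro add_mono mult_right_mono) (auto simp: r_def)
    also have "\<dots> \<le> 36 / d * norm (y - x)" using r by simp
    finally show ?thesis .
  qed
  have lip: "(36 / d)-lipschitz_on V g"
    using g_lip d_pos by (auto intro!: lipschitz_onI simp: dist_norm norm_minus_commute)
  have C11: "C11_on {x. u \<bullet> x = 0} V f"
    unfolding C11_on_def
    using deriv g_perp lip lipschitz_on_continuous_on[OF lip] by (intro exI[of _ g]) auto
  have openN: "open N"
    unfolding N_def pr_def by (intro open_Collect_conj open_Collect_less continuous_intros)
  have "V = {x. u \<bullet> x = 0} \<inter> ball (pr p) (d / 2)"
    by (auto simp: V_def dist_norm norm_minus_commute)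
  then have openV: "openin (top_of_set {x. u \<bullet> x = 0}) V" by (auto simp: openin_open_Int)
  have "p \<in> N" using d_pos by (simp add: N_def t0_def)
  with nu openN openV C11 graph
  show "\<exists>u N V f. norm u = 1 \<and> open N \<and> p \<in> N \<and>
        openin (top_of_set {x. u \<bullet> x = 0}) V \<and> C11_on {x. u \<bullet> x = 0} V f \<and>
        frontier W \<inter> N = (\<lambda>x. x + f x *\<^sub>R u) ` V"
    by blast
qed

end

section \<open>Unions of inner balls\<close>

text \<open>The morphological opening of \<open>K\<close>: an erosion followed by a
  dilation.\<close>

lemma union_of_inner_balls_eq: "union_of_inner_balls d K = parallel_body d (inner_parallel d K)"
proof (rule set_eqI)
  fix y
  have "y \<in> union_of_inner_balls d K \<longleftrightarrow> (\<exists>x. cball x d \<subseteq> K \<and> y \<in> cball x d)"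
    unfolding union_of_inner_balls_def by blast
  then show "y \<in> union_of_inner_balls d K \<longleftrightarrow> y \<in> parallel_body d (inner_parallel d K)"
    by (simp add: mem_parallel_body inner_parallel_def)
qed

text \<open>A point of \<open>frontier K\<close> in \<open>W\<close> cannot be interior to
  \<open>W\<close>, so it lies on \<open>frontier W\<close>. The other half of the difference is
  covered by the projection of \<open>frontier K - W\<close>, hence the factor 2.\<close>

lemma hausdorff_measure_sym_diff_frontier_le:
  fixes K W :: "'a::euclidean_space set"
  assumes "0 \<le> s" "bounded K" "convex W" "closed W" "W \<noteq> {}" "W \<subseteq> K"
  shows "hausdorff_measure s (sym_diff (frontier K) (frontier W)) \<le> 2 * hausdorff_measure s (frontier K - W)"
proof -
  have "frontier K - frontier W \<subseteq> frontier K - W"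
    using interior_mono[OF \<open>W \<subseteq> K\<close>] closure_subset[of W] by (auto simp: frontier_def)
  then have "hausdorff_measure s (frontier K - frontier W) \<le> hausdorff_measure s (frontier K - W)"
    by (rule hausdorff_measure_mono)
  moreover have "hausdorff_measure s (frontier W - frontier K) \<le> hausdorff_measure s (frontier K - W)"
  proof -
    have "hausdorff_measure s (frontier W - frontier K)
        \<le> hausdorff_measure s (closest_point W ` (frontier K - W))"
      using assms by (intro hausdorff_measure_mono frontier_diff_subset_closest_point_image)
    also have "\<dots> \<le> hausdorff_measure s (frontier K - W)"
      using assms by (intro hausdorff_measure_closest_point_image)
    finally show ?thesis .
  qed
  ultimately show ?thesis
    using hausdorff_measure_Un[of s "frontier K - frontier W" "frontier W - frontier K"]
    by (simp add: mult_2) (meson add_mono order_trans)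
qed

text \<open>At least the fraction \<open>q\<close> of the boundary measure of \<open>K\<close> lies
  in the union of inner balls, and additivity for this closed set leaves at most
  \<open>(1 - q) * m\<close> outside.\<close>

lemma hausdorff_measure_frontier_Diff_inner_balls_le:
  fixes K :: "'a::euclidean_space set"
  assumes K: "compact K" "convex K" "cball c r \<subseteq> K" and d: "0 < d" "d < r"
    and s: "0 \<le> s" and m: "hausdorff_measure s (frontier K) = ennreal m" "0 \<le> m"
    and closed: "closed (union_of_inner_balls d K)"
  shows "hausdorff_measure s (frontier K - union_of_inner_balls d K)
    \<le> ennreal (m * (1 - (1 - d / r) powr s))"
proof -
  define W where "W = union_of_inner_balls d K"
  let ?H = "hausdorff_measure s"
  define q where "q = (1 - d / r) powr s"
  have "0 \<le> q" by (simp add: q_def)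
  have A_ne: "inner_parallel d K \<noteq> {}"
    using K(3) d by (auto simp: inner_parallel_def intro!: exI[of _ c] order_trans[OF subset_cball[of d r]])
  have "ennreal (q * m) \<le> ?H (frontier (inner_parallel d K))"
    using hausdorff_measure_frontier_le_inner_parallel[OF s K(1,2,3) d] m
    by (simp add: q_def ennreal_mult)
  also have "\<dots> \<le> ?H (closest_point (inner_parallel d K) ` (frontier K \<inter> W))"
    unfolding W_def using K d by (intro hausdorff_measure_mono frontier_inner_parallel_subset)
  also have "\<dots> \<le> ?H (frontier K \<inter> W)"
    using s K A_ne by (intro hausdorff_measure_closest_point_image convex_inner_parallel
        closed_inner_parallel compact_imp_closed)
  finally have "ennreal (q * m) + ?H (frontier K - W) \<le> ?H (frontier K \<inter> W) + ?H (frontier K - W)"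
    by (rule add_right_mono)
  also have "\<dots> \<le> ennreal m"
    using hausdorff_measure_Int_Diff_closed[OF closed, of s "frontier K"] m by (simp add: W_def)
  finally have le: "ennreal (q * m) + ?H (frontier K - W) \<le> ennreal m" .
  then have "?H (frontier K - W) \<le> ennreal m"
    by (metis add.commute add_increasing2 order_trans zero_le order_refl)
  \<comment> \<open>Finiteness permits the subtraction to be done in the reals.\<close>
  then obtain b where b: "?H (frontier K - W) = ennreal b" "0 \<le> b"
    by (cases "?H (frontier K - W)") (auto simp: top_unique)
  with le have "q * m + b \<le> m"
    using \<open>0 \<le> q\<close> m(2) by (simp flip: ennreal_plus)
  then have "b \<le> m * (1 - q)" by (simp add: algebra_simps)
  then show ?thesis using b by (simp add: W_def q_def ennreal_leI)
qed

text \<open>Since \<open>d < r\<close>, the centre \<open>c\<close> lies in the inner parallel body,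
  which is therefore nonempty, and the results on outer parallel bodies apply to it.\<close>

lemma union_of_inner_balls_convex_body:
  fixes K :: "'a::euclidean_space set"
  assumes K: "compact K" "convex K" "cball c r \<subseteq> K" and d: "0 < d" "d < r"
  shows "convex_body (union_of_inner_balls d K)" "C11_boundary (union_of_inner_balls d K)"
    "union_of_inner_balls d K \<subseteq> K"
proof -
  have "c \<in> inner_parallel d K"
    using K(3) d by (auto simp: inner_parallel_def subset_iff)
  moreover have "compact (inner_parallel d K)"
  proof -
    have "inner_parallel d K \<subseteq> K" using d by (intro inner_parallel_subset) simp
    then show ?thesis
      using closed_inner_parallel[OF compact_imp_closed[OF K(1)]] bounded_subset[OF compact_imp_bounded[OF K(1)]]
      by (simp add: compact_eq_bounded_closed)
  qed
  ultimately interpret convex_parallel "inner_parallel d K" d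
    using convex_inner_parallel[OF K(2)] d by unfold_locales auto
  show "convex_body (union_of_inner_balls d K)" "C11_boundary (union_of_inner_balls d K)"
    unfolding union_of_inner_balls_eq by (rule convex_body_W C11_boundary_W)+
  show "union_of_inner_balls d K \<subseteq> K"
    by (auto simp: union_of_inner_balls_def)
qed

lemma inner_balls_approximation:
  fixes K :: "'a::euclidean_space set"
  assumes K: "convex_body K" and "0 < \<epsilon>"
  shows "\<exists>\<delta>\<^sub>0>0. \<forall>\<delta>. 0 < \<delta> \<and> \<delta> < \<delta>\<^sub>0 \<longrightarrow>
    (let W = union_of_inner_balls \<delta> K in convex_body W \<and> W \<subseteq> K \<and> C11_boundary W \<and>
      hausdorff_measure (real DIM('a) - 1) (sym_diff (frontier K) (frontier W)) < ennreal \<epsilon>)"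
proof -
  define s where "s = real DIM('a) - 1"
  have "0 \<le> s" by (simp add: s_def Suc_leI)
  have K': "compact K" "convex K" and "interior K \<noteq> {}"
    using K by (auto simp: convex_body_def)
  then obtain c r where r: "0 < r" "cball c r \<subseteq> K" by (auto simp: mem_interior_cball)
  obtain m where m: "hausdorff_measure s (frontier K) = ennreal m" "0 \<le> m"
    using hausdorff_measure_frontier_finite[OF K'(2,1)]
    by (cases "hausdorff_measure s (frontier K)") (auto simp: s_def)
  \<comment> \<open>The limit value is 0, and the base of the power tends to 1, where
    \<open>powr\<close> is continuous.\<close>
  have "((\<lambda>d. 2 * (m * (1 - (1 - d / r) powr s))) \<longlongrightarrow> 2 * (m * (1 - (1 - 0 / r) powr s))) (at_right 0)"
    using r(1) by (intro tendsto_intros) auto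
  then have "\<forall>\<^sub>F d in at_right 0. 2 * (m * (1 - (1 - d / r) powr s)) < \<epsilon>"
    using \<open>0 < \<epsilon>\<close> by (auto dest: order_tendstoD(2)[of _ _ _ \<epsilon>])
  then obtain d0 where d0: "0 < d0" "\<And>d. 0 < d \<Longrightarrow> d < d0 \<Longrightarrow> 2 * (m * (1 - (1 - d / r) powr s)) < \<epsilon>"
    by (auto simp: eventually_at_right_field)
  have main: "hausdorff_measure s (sym_diff (frontier K) (frontier (union_of_inner_balls d K))) < ennreal \<epsilon>"
    if d: "0 < d" "d < min d0 r" for d
  proof -
    define W where "W = union_of_inner_balls d K"
    have W: "convex_body W" "W \<subseteq> K"
      using union_of_inner_balls_convex_body[OF K' r(2)] d by (auto simp: W_def)
    then have W': "convex W" "closed W" "W \<noteq> {}"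
      by (auto simp: convex_body_def compact_imp_closed)
    have "hausdorff_measure s (sym_diff (frontier K) (frontier W)) \<le> 2 * hausdorff_measure s (frontier K - W)"
      using \<open>0 \<le> s\<close> compact_imp_bounded[OF K'(1)] W' W(2) by (rule hausdorff_measure_sym_diff_frontier_le)
    also have "\<dots> \<le> 2 * ennreal (m * (1 - (1 - d / r) powr s))"
      using hausdorff_measure_frontier_Diff_inner_balls_le[OF K' r(2) _ _ \<open>0 \<le> s\<close> m] W'(2) d
      by (intro mult_left_mono) (auto simp: W_def)
    also have "\<dots> = ennreal (2 * (m * (1 - (1 - d / r) powr s)))"
      by (simp add: ennreal_mult')
    also have "\<dots> < ennreal \<epsilon>"
      using d0(2)[of d] d \<open>0 < \<epsilon>\<close> by (intro ennreal_lessI) auto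
    finally show ?thesis by (simp add: W_def)
  qed
  show ?thesis
  proof (intro exI[of _ "min d0 r"] conjI allI impI)
    show "0 < min d0 r" using d0 r by simp
    fix d assume d: "0 < d \<and> d < min d0 r"
    then show "let W = union_of_inner_balls d K in convex_body W \<and> W \<subseteq> K \<and> C11_boundary W \<and>
      hausdorff_measure (real DIM('a) - 1) (sym_diff (frontier K) (frontier W)) < ennreal \<epsilon>"
      using main[of d] union_of_inner_balls_convex_body[OF K' r(2), of d] by (simp add: Let_def s_def)
  qed
qed

theorem theorem1p4:
  fixes K :: "(real ^ 'n) set"
  assumes "convex_body K"
  shows "(\<forall>\<epsilon>::real. \<epsilon> > 0 \<longrightarrow>
            (\<exists>W. convex_body W \<and> W \<subseteq> K \<and> C11_boundary W \<and>
               hausdorff_measure (real CARD('n) - 1) (sym_diff (frontier K) (frontier W)) < ennreal \<epsilon>)) \<and>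
         (\<forall>\<epsilon>::real. \<epsilon> > 0 \<longrightarrow>
            (\<exists>\<delta>\<^sub>0::real. \<delta>\<^sub>0 > 0 \<and>
               (\<forall>\<delta>::real. 0 < \<delta> \<and> \<delta> < \<delta>\<^sub>0 \<longrightarrow>
                  (let W = union_of_inner_balls \<delta> K in
                     convex_body W \<and> W \<subseteq> K \<and> C11_boundary W \<and>
                     hausdorff_measure (real CARD('n) - 1) (sym_diff (frontier K) (frontier W)) < ennreal \<epsilon>))))"
proof -
  have balls: "\<exists>\<delta>\<^sub>0::real. \<delta>\<^sub>0 > 0 \<and>
               (\<forall>\<delta>::real. 0 < \<delta> \<and> \<delta> < \<delta>\<^sub>0 \<longrightarrow>
                  (let W = union_of_inner_balls \<delta> K in
                     convex_body W \<and> W \<subseteq> K \<and> C11_boundary W \<and>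
                     hausdorff_measure (real CARD('n) - 1) (sym_diff (frontier K) (frontier W)) < ennreal \<epsilon>))"
    if "\<epsilon> > 0" for \<epsilon> :: real
    using inner_balls_approximation[OF assms that] by simp
  \<comment> \<open>Any radius below the threshold gives a suitable body; half the threshold is
    taken.\<close>
  moreover have "\<exists>W. convex_body W \<and> W \<subseteq> K \<and> C11_boundary W \<and>
      hausdorff_measure (real CARD('n) - 1) (sym_diff (frontier K) (frontier W)) < ennreal \<epsilon>"
    if pos: "\<epsilon> > 0" for \<epsilon> :: real
  proof -
    obtain \<delta>\<^sub>0 where "\<delta>\<^sub>0 > 0" and \<delta>\<^sub>0: "\<And>\<delta>. 0 < \<delta> \<Longrightarrow> \<delta> < \<delta>\<^sub>0 \<Longrightarrow>
        (let W = union_of_inner_balls \<delta> K in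
           convex_body W \<and> W \<subseteq> K \<and> C11_boundary W \<and>
           hausdorff_measure (real CARD('n) - 1) (sym_diff (frontier K) (frontier W)) < ennreal \<epsilon>)"
      using balls[OF pos] by blast
    from \<delta>\<^sub>0[of "\<delta>\<^sub>0 / 2"] \<open>\<delta>\<^sub>0 > 0\<close> show ?thesis
      unfolding Let_def by auto
  qed
  ultimately show ?thesis by blast
qed

end
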